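(* Let $(X,d)$, $G$, $o$ be as in the context, let $(\omega_n)_n$ be the random walk generated by a non-elementary probability measure $\mu$ on $G$, and let $\lambda(\mu)\in(0,+\infty]$ be the almost sure limit of $d(o,\omega_n o)/n$. Then for every $0<L<\lambda(\mu)$ there exists $K>0$ such that for all $n$, \[ \mathbb P\big[d(o,\omega_n o)\le Ln\big]\le K e^{-n/K}. \]
   Context: $(X,d)$ is a geodesic metric space, $G$ is a countable group of isometries of $X$ containing two independent contracting isometries, and $o\in X$ a basepoint. For $A\subseteq X$, $\pi_A(x)=\{a\in A: d(x,a)=d(x,A)\}$; $A$ is $K$-contracting if $\pi_A(z)\ne\emptyset$ for all $z$ and $d(x,y)\le d(x,A)-K$ implies $\operatorname{diam}(\pi_A(x)\cup\pi_A(y))\le K$. A $K$-quasigeodesic is a map $\gamma$ from a set of consecutive integers (or an interval) to $X$ with $|s-t|/K-K\le d(\gamma(s),\gamma(t))\le K|s-t|+K$. An isometry $g$ is contracting if $n\in\mathbb Z\mapsto g^no$ is a $K$-quasigeodesic with $K$-contracting image for some $K$. $g,h$ are independent if $\{(n,m):d(g^no,h^mo)<M\}$ is bounded for each $M>0$. $\mu$ is non-elementary if the semigroup generated by $\operatorname{supp}\mu$ contains two independent contracting isometries. $\omega_n=g_1\cdots g_n$ with $(g_i)$ i.i.d. of law $\mu$; the limit $\lambda(\mu)=\lim_n d(o,\omega_no)/n$ exists almost surely and is a constant in $(0,+\infty]$. *)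

theory Defs
  imports "HOL-Probability.Probability"
begin

definition geodesic_space :: "'a::metric_space itself \<Rightarrow> bool" where
  "geodesic_space _ \<longleftrightarrow>
     (\<forall>x y::'a. \<exists>\<gamma>::real \<Rightarrow> 'a. \<gamma> 0 = x \<and> \<gamma> (dist x y) = y \<and>
        (\<forall>s\<in>{0..dist x y}. \<forall>t\<in>{0..dist x y}. dist (\<gamma> s) (\<gamma> t) = \<bar>s - t\<bar>))"

definition isometry :: "('a::metric_space \<Rightarrow> 'a) \<Rightarrow> bool" where
  "isometry f \<longleftrightarrow> bij f \<and> (\<forall>x y. dist (f x) (f y) = dist x y)"

definition isometry_group :: "('a::metric_space \<Rightarrow> 'a) set \<Rightarrow> bool" where
  "isometry_group G \<longleftrightarrow> id \<in> G \<and> (\<forall>g\<in>G. isometry g) \<and>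
     (\<forall>g\<in>G. \<forall>h\<in>G. g \<circ> h \<in> G) \<and> (\<forall>g\<in>G. inv g \<in> G)"

definition proj_set :: "'a::metric_space set \<Rightarrow> 'a \<Rightarrow> 'a set" where
  "proj_set A x = {a \<in> A. dist x a = infdist x A}"

text \<open>A is K-contracting (diameter of the union of projections is at most K,
  written out as a bound on all pairwise distances).\<close>
definition contracting_set :: "real \<Rightarrow> 'a::metric_space set \<Rightarrow> bool" where
  "contracting_set K A \<longleftrightarrow> (\<forall>z. proj_set A z \<noteq> {}) \<and>
     (\<forall>x y. dist x y \<le> infdist x A - K \<longrightarrow>
        (\<forall>a\<in>proj_set A x \<union> proj_set A y. \<forall>b\<in>proj_set A x \<union> proj_set A y. dist a b \<le> K))"

definition quasi_geodesic :: "real \<Rightarrow> (int \<Rightarrow> 'a::metric_space) \<Rightarrow> bool" where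
  "quasi_geodesic K \<gamma> \<longleftrightarrow> (\<forall>s t. \<bar>real_of_int (s - t)\<bar> / K - K \<le> dist (\<gamma> s) (\<gamma> t) \<and>
        dist (\<gamma> s) (\<gamma> t) \<le> K * \<bar>real_of_int (s - t)\<bar> + K)"

definition zpow :: "('a \<Rightarrow> 'a) \<Rightarrow> int \<Rightarrow> ('a \<Rightarrow> 'a)" where
  "zpow g n = (if 0 \<le> n then g ^^ nat n else inv g ^^ nat (- n))"

definition contracting_isometry :: "'a::metric_space \<Rightarrow> ('a \<Rightarrow> 'a) \<Rightarrow> bool" where
  "contracting_isometry x0 g \<longleftrightarrow> isometry g \<and>
     (\<exists>K>0. quasi_geodesic K (\<lambda>n. zpow g n x0) \<and> contracting_set K (range (\<lambda>n. zpow g n x0)))"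

definition independent :: "'a::metric_space \<Rightarrow> ('a \<Rightarrow> 'a) \<Rightarrow> ('a \<Rightarrow> 'a) \<Rightarrow> bool" where
  "independent x0 g h \<longleftrightarrow> (\<forall>M>0. \<exists>B::int. \<forall>n m.
     dist (zpow g n x0) (zpow h m x0) < M \<longrightarrow> \<bar>n\<bar> \<le> B \<and> \<bar>m\<bar> \<le> B)"

inductive_set semigroup_gen :: "('a \<Rightarrow> 'a) set \<Rightarrow> ('a \<Rightarrow> 'a) set" for S where
  base: "s \<in> S \<Longrightarrow> s \<in> semigroup_gen S"
| comp: "a \<in> semigroup_gen S \<Longrightarrow> b \<in> semigroup_gen S \<Longrightarrow> a \<circ> b \<in> semigroup_gen S"

definition non_elementary :: "'a::metric_space \<Rightarrow> ('a \<Rightarrow> 'a) pmf \<Rightarrow> bool" where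
  "non_elementary x0 \<mu> \<longleftrightarrow> (\<exists>g h. g \<in> semigroup_gen (set_pmf \<mu>) \<and> h \<in> semigroup_gen (set_pmf \<mu>) \<and>
     contracting_isometry x0 g \<and> contracting_isometry x0 h \<and> independent x0 g h)"

definition walk_path :: "('a \<Rightarrow> 'a) stream \<Rightarrow> nat \<Rightarrow> ('a \<Rightarrow> 'a)" where
  "walk_path s n = foldr (\<circ>) (stake n s) id"

primrec walk_law :: "('a \<Rightarrow> 'a) pmf \<Rightarrow> nat \<Rightarrow> ('a \<Rightarrow> 'a) pmf" where
  "walk_law \<mu> 0 = return_pmf id"
| "walk_law \<mu> (Suc n) = bind_pmf (walk_law \<mu> n) (\<lambda>w. map_pmf (\<lambda>g. w \<circ> g) \<mu>)"

end

theory Submission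
  imports Defs "HOL-Real_Asymp.Real_Asymp"
begin

text \<open>
  Put \<open>\<phi>\<^sub>t(n) = E exp (- t d(o, \<omega>\<^sub>n o))\<close>. From two independent contracting isometries one builds five
  group elements of equal word length such that, for all points \<open>x, y\<close>, all but at most one \<open>s\<close> of
  them is aligned with \<open>x\<close> on the left, all but at most one is aligned with \<open>y\<close> on the right, and
  \<open>d(x, s y) \<ge> d(x, o) + d(o, y) - C\<close> when both alignments hold. Inside a window of \<open>m\<close> consecutive
  blocks of the walk, left alignment of a block depends on the past only and right alignment on the
  future only; the probability that no block of the window is aligned on both sides is at most
  \<open>\<delta>\<^sup>m\<close> with \<open>\<delta> < 1\<close>. Splitting the walk at an aligned block gives, with \<open>C\<close> and \<open>\<delta>\<close> independent of \<open>t\<close>,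
  \<open>\<phi>\<^sub>t(a + m q + b) \<le> e\<^bsup>tC\<^esup> (\<Sum>i<m. \<phi>\<^sub>t(a + i q) \<phi>\<^sub>t((m - 1 - i) q + b)) + \<delta>\<^sup>m\<close>. No moment condition is needed.
  For \<open>L < L' < \<lambda>\<close> one has \<open>\<phi>\<^sub>t(n) \<le> e\<^bsup>- t L' n\<^esup> + o(1)\<close>; taking \<open>t\<close> of order \<open>1 / N\<close> for a large scale \<open>N\<close>
  and windows in the middle of the walk, the recursion propagates this to
  \<open>\<phi>\<^sub>t(n) \<le> e\<^bsup>- t L n - \<theta> n\<^esup>\<close> for all \<open>n \<ge> N\<close>, and Markov's inequality concludes.
\<close>

section \<open>Contracting sets\<close>

lemma geodesic_point:
  fixes x y :: "'a::metric_space"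
  assumes "geodesic_space TYPE('a)" "0 \<le> r" "r \<le> dist x y"
  obtains z where "dist x z = r" "dist z y = dist x y - r"
proof -
  obtain \<gamma> :: "real \<Rightarrow> 'a" where \<gamma>: "\<gamma> 0 = x" "\<gamma> (dist x y) = y"
    and iso: "\<And>s t. s \<in> {0..dist x y} \<Longrightarrow> t \<in> {0..dist x y} \<Longrightarrow> dist (\<gamma> s) (\<gamma> t) = \<bar>s - t\<bar>"
    using assms(1) unfolding geodesic_space_def by metis
  have "dist x (\<gamma> r) = r" using iso[of 0 r] \<gamma> assms by auto
  moreover have "dist (\<gamma> r) y = dist x y - r" using iso[of r "dist x y"] \<gamma> assms by auto
  ultimately show ?thesis using that by blast
qed

lemma proj_setD:
  assumes "a \<in> proj_set A x" shows "a \<in> A" "dist x a = infdist x A"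
  using assms by (auto simp: proj_set_def)

lemma proj_set_self:
  assumes "a \<in> A" shows "proj_set A a = {a}"
  using assms by (auto simp: proj_set_def)

lemma contracting_set_nonempty:
  assumes "contracting_set K A" obtains a where "a \<in> proj_set A x"
  using assms that unfolding contracting_set_def by blast

lemma contracting_setD:
  assumes "contracting_set K A" "dist x y \<le> infdist x A - K"
    "a \<in> proj_set A x" "b \<in> proj_set A y"
  shows "dist a b \<le> K"
  using assms unfolding contracting_set_def by blast

lemma contracting_set_mono:
  assumes "contracting_set K A" "K \<le> K'" shows "contracting_set K' A"
  using assms unfolding contracting_set_def by (smt (verit, best))

text \<open>If \<open>dist x y\<close> were smaller, the point \<open>z\<close> of a geodesic at
  distance \<open>infdist x A - K\<close> from \<open>x\<close> would lie within
  \<open>infdist y A - K\<close> of \<open>y\<close>. Contraction from both ends then puts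
  \<open>a\<close> and \<open>b\<close> within \<open>K\<close> of one projection of
  \<open>z\<close>, against \<open>far\<close>.\<close>

lemma far_projections:
  fixes x y :: "'a::metric_space"
  assumes geo: "geodesic_space TYPE('a)" and A: "contracting_set K A" and "0 \<le> K"
    and a: "a \<in> proj_set A x" and b: "b \<in> proj_set A y" and far: "2 * K < dist a b"
  shows "infdist x A + infdist y A - 2 * K \<le> dist x y"
proof (rule ccontr)
  assume "\<not> ?thesis"
  then have lt: "dist x y < infdist x A + infdist y A - 2 * K" by simp
  \<comment> \<open>Contraction cannot apply between \<open>x\<close> and \<open>y\<close>
    themselves. This and its mirror image put \<open>infdist x A - K\<close> between 0 and
    \<open>dist x y\<close>, so that \<open>z\<close> exists.\<close>
  have nx: "\<not> dist x y \<le> infdist x A - K"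
    using contracting_setD[OF A _ a b] far \<open>0 \<le> K\<close> by linarith
  have ny: "\<not> dist y x \<le> infdist y A - K"
    using contracting_setD[OF A _ b a] far \<open>0 \<le> K\<close> by (smt (verit) dist_commute)
  have "0 \<le> infdist x A - K" using lt ny by (simp add: dist_commute)
  then obtain z where z: "dist x z = infdist x A - K" "dist z y = dist x y - (infdist x A - K)"
    using geodesic_point[OF geo, of "infdist x A - K" x y] nx by auto
  obtain c where c: "c \<in> proj_set A z" using contracting_set_nonempty[OF A] .
  have "dist a c \<le> K" using contracting_setD[OF A _ a c] z by simp
  moreover have "dist b c \<le> K" using contracting_setD[OF A _ b c] z lt by (simp add: dist_commute)
  ultimately show False using far dist_triangle2[of a b c] by simp
qed

text \<open>Walk from \<open>y\<close> to \<open>z\<close> in steps of length \<open>infdist y A - K\<close>: each step of length at least \<open>K\<close>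
  moves the projection by at most \<open>K\<close>.\<close>

lemma dist_to_contracting_point_weak:
  fixes y z :: "'a::metric_space"
  assumes geo: "geodesic_space TYPE('a)" and A: "contracting_set K A" and "0 < K"
    and z: "z \<in> A" and "a \<in> proj_set A y"
  shows "dist a z - 2 * K \<le> dist y z"
proof -
  have "\<forall>y a. dist y z \<le> real n * K \<longrightarrow> a \<in> proj_set A y \<longrightarrow> dist a z - 2 * K \<le> dist y z" for n
  proof (induction n)
    case 0
    then show ?case using proj_set_self[OF z] \<open>0 < K\<close> by auto
  next
    case (Suc n)
    show ?case
    proof (intro allI impI)
      fix y a assume le: "dist y z \<le> real (Suc n) * K" and a: "a \<in> proj_set A y"
      show "dist a z - 2 * K \<le> dist y z"
      proof (cases "infdist y A < 2 * K")
        case True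
        then show ?thesis using proj_setD[OF a] dist_triangle3[of a z y] by simp
      next
        case False
        have "infdist y A \<le> dist y z" by (rule infdist_le[OF z])
        then obtain y' where y': "dist y y' = infdist y A - K" "dist y' z = dist y z - (infdist y A - K)"
          using geodesic_point[OF geo, of "infdist y A - K" y z] False \<open>0 < K\<close> by auto
        obtain a' where a': "a' \<in> proj_set A y'" using contracting_set_nonempty[OF A] .
        have "dist a a' \<le> K" using contracting_setD[OF A _ a a'] y' by simp
        moreover have "dist a' z - 2 * K \<le> dist y' z"
          using Suc a' y' le False by (auto simp: algebra_simps)
        ultimately show ?thesis using y' False dist_triangle[of a z a'] by linarith
      qed
    qed
  qed
  moreover obtain n where "dist y z \<le> real n * K"
    using reals_Archimedean3[OF \<open>0 < K\<close>] less_imp_le by blast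
  ultimately show ?thesis using assms by blast
qed

text \<open>One step of length \<open>infdist y A - K\<close> towards \<open>z\<close> moves the
  projection by at most \<open>K\<close>; the weak bound applies from the end of that step. The
  result is a reversed triangle inequality for the path through the projection.\<close>

lemma dist_to_contracting_point:
  fixes y z :: "'a::metric_space"
  assumes geo: "geodesic_space TYPE('a)" and A: "contracting_set K A" and "0 < K"
    and z: "z \<in> A" and a: "a \<in> proj_set A y"
  shows "dist y a + dist a z - 4 * K \<le> dist y z"
proof (cases "infdist y A < K")
  case True
  then show ?thesis using proj_setD[OF a] dist_triangle3[of a z y] \<open>0 < K\<close> by simp
next
  case False
  have "infdist y A \<le> dist y z" by (rule infdist_le[OF z])
  then obtain y' where y': "dist y y' = infdist y A - K" "dist y' z = dist y z - (infdist y A - K)"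
    using geodesic_point[OF geo, of "infdist y A - K" y z] False \<open>0 < K\<close> by auto
  obtain a' where a': "a' \<in> proj_set A y'" using contracting_set_nonempty[OF A] .
  have "dist a a' \<le> K" using contracting_setD[OF A _ a a'] y' by simp
  moreover have "dist a' z - 2 * K \<le> dist y' z"
    by (rule dist_to_contracting_point_weak[OF geo A \<open>0 < K\<close> z a'])
  ultimately show ?thesis using y' proj_setD[OF a] dist_triangle[of a z a'] by linarith
qed

text \<open>Behrstock's inequality: two instances of \<open>far_projections\<close> are added, and
  the distances from \<open>x\<close> to \<open>A\<close> and to \<open>B\<close> cancel.\<close>

lemma behrstock:
  fixes x :: "'a::metric_space"
  assumes geo: "geodesic_space TYPE('a)" and "0 \<le> K"
    and A: "contracting_set K A" and B: "contracting_set K B"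
    and a: "a \<in> proj_set A x" and b: "b \<in> proj_set B x"
    and a': "a' \<in> proj_set A b" and b': "b' \<in> proj_set B a"
    and "2 * K < dist a a'" "2 * K < dist b b'"
  shows "infdist a B + infdist b A \<le> 4 * K"
proof -
  have "infdist x A + infdist b A - 2 * K \<le> dist x b"
    by (rule far_projections[OF geo A \<open>0 \<le> K\<close> a a']) fact
  moreover have "infdist x B + infdist a B - 2 * K \<le> dist x a"
    by (rule far_projections[OF geo B \<open>0 \<le> K\<close> b b']) fact
  ultimately show ?thesis using proj_setD[OF a] proj_setD[OF b] by simp
qed

text \<open>The point \<open>a\<close> is almost on the way from \<open>y\<close> to
  \<open>x0\<close>, both in \<open>B\<close>, and its projection \<open>c\<close> to
  \<open>B\<close> is almost on the way from \<open>a\<close> to each of them. The sum of the three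
  estimates, each with error \<open>4 * K\<close>, counts \<open>dist a c\<close> twice.\<close>

lemma proj_of_contracting_near:
  fixes x0 :: "'a::metric_space"
  assumes geo: "geodesic_space TYPE('a)" and "0 < K"
    and A: "contracting_set K A" and B: "contracting_set K B"
    and x0: "x0 \<in> A" "x0 \<in> B" and y: "y \<in> B" and a: "a \<in> proj_set A y"
  shows "infdist a B \<le> 6 * K"
proof -
  obtain c where c: "c \<in> proj_set B a" using contracting_set_nonempty[OF B] .
  note F = dist_to_contracting_point[OF geo _ \<open>0 < K\<close>]
  have "dist y a + dist a x0 - 4 * K \<le> dist y x0" by (rule F[OF A x0(1) a])
  moreover have "dist a c + dist c x0 - 4 * K \<le> dist a x0" by (rule F[OF B x0(2) c])
  moreover have "dist a c + dist c y - 4 * K \<le> dist a y" by (rule F[OF B y c])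
  ultimately show ?thesis
    using proj_setD[OF c] dist_triangle[of y x0 c] by (simp add: dist_commute)
qed

section \<open>Isometries and integer powers\<close>

lemma isometryD:
  assumes "isometry f" shows "bij f" "dist (f x) (f y) = dist x y"
  using assms by (auto simp: isometry_def)

lemma isometry_id: "isometry id" by (simp add: isometry_def)

lemma isometry_comp: "isometry f \<Longrightarrow> isometry g \<Longrightarrow> isometry (f \<circ> g)"
  by (auto simp: isometry_def bij_comp)

lemma isometry_inv: "isometry f \<Longrightarrow> isometry (inv f)"
  unfolding isometry_def by (metis bij_imp_bij_inv bij_inv_eq_iff)

lemma dist_isometry_inv:
  assumes "isometry f" shows "dist (inv f x) y = dist x (f y)"
  using assms unfolding isometry_def by (metis bij_inv_eq_iff)

lemma isometry_funpow: "isometry f \<Longrightarrow> isometry (f ^^ n)"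
  by (induction n) (simp_all only: funpow.simps isometry_id isometry_comp)

lemma isometry_zpow: "isometry f \<Longrightarrow> isometry (zpow f n)"
  by (simp add: zpow_def isometry_funpow isometry_inv)

lemma infdist_image_isometry:
  assumes "isometry f" shows "infdist (f x) (f ` A) = infdist x A"
  using assms by (simp add: infdist_def isometryD image_image)

lemma proj_set_image_isometry:
  assumes "isometry f" shows "proj_set (f ` A) (f x) = f ` proj_set A x"
  using assms by (auto simp: proj_set_def infdist_image_isometry isometryD)

lemma contracting_set_image_isometry:
  assumes f: "isometry f" and A: "contracting_set K A" shows "contracting_set K (f ` A)"
proof -
  have ex: "\<exists>u. z = f u" for z using isometryD(1)[OF f] by (metis bij_pointE)
  show ?thesis
    unfolding contracting_set_def
  proof (intro conjI allI impI)
    fix z show "proj_set (f ` A) z \<noteq> {}"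
      using ex[of z] A proj_set_image_isometry[OF f] by (auto simp: contracting_set_def)
  next
    fix x y assume le: "dist x y \<le> infdist x (f ` A) - K"
    obtain u v where uv: "x = f u" "y = f v" using ex by meson
    have "dist u v \<le> infdist u A - K"
      using le uv f by (simp add: infdist_image_isometry isometryD)
    then have "\<forall>a\<in>proj_set A u \<union> proj_set A v. \<forall>b\<in>proj_set A u \<union> proj_set A v. dist a b \<le> K"
      using A by (auto simp: contracting_set_def)
    then show "\<forall>a\<in>proj_set (f ` A) x \<union> proj_set (f ` A) y. \<forall>b\<in>proj_set (f ` A) x \<union> proj_set (f ` A) y. dist a b \<le> K"
      using uv f by (auto simp: proj_set_image_isometry isometryD)
  qed
qed

lemma zpow_0: "zpow g 0 = id" by (simp add: zpow_def)

lemma zpow_of_nat: "zpow g (int n) = g ^^ n" by (simp add: zpow_def)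

lemma zpow_Suc:
  assumes "bij g" shows "zpow g (n + 1) = g \<circ> zpow g n"
proof (cases "0 \<le> n")
  case True
  then have "nat (n + 1) = Suc (nat n)" by simp
  with True show ?thesis by (simp add: zpow_def)
next
  case False
  then have eq: "nat (- n) = Suc (nat (- (n + 1)))" by simp
  have "g \<circ> zpow g n = inv g ^^ nat (- (n + 1))"
    using False assms unfolding zpow_def eq
    by (simp add: o_assoc surj_iff[THEN iffD1] bij_is_surj)
  then show ?thesis using False by (cases "n = -1") (auto simp: zpow_def)
qed

lemma zpow_add:
  assumes "bij g" shows "zpow g (m + n) = zpow g m \<circ> zpow g n"
proof (induction m rule: int_induct[where k = 0])
  case base
  show ?case by (simp add: zpow_0)
next
  case (step1 i)
  have "zpow g (i + 1 + n) = g \<circ> zpow g (i + n)" using zpow_Suc[OF assms, of "i + n"] by (simp add: ac_simps)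
  then show ?case using step1 zpow_Suc[OF assms, of i] by (simp add: o_assoc)
next
  case (step2 i)
  have "zpow g (i + n) = g \<circ> zpow g (i - 1 + n)" "zpow g i = g \<circ> zpow g (i - 1)"
    using zpow_Suc[OF assms, of "i - 1 + n"] zpow_Suc[OF assms, of "i - 1"] by (simp_all add: algebra_simps)
  with step2 have "g \<circ> zpow g (i - 1 + n) = g \<circ> (zpow g (i - 1) \<circ> zpow g n)"
    by (metis comp_assoc)
  then have "inv g \<circ> g \<circ> zpow g (i - 1 + n) = inv g \<circ> g \<circ> (zpow g (i - 1) \<circ> zpow g n)"
    by (simp only: comp_assoc)
  then show ?case using assms by (simp add: bij_is_inj)
qed

section \<open>Projections between two independent axes\<close>

lemma independent_sym: "independent x0 g h \<Longrightarrow> independent x0 h g"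
  unfolding independent_def by (metis dist_commute)

lemma quasi_geodesic_mono:
  assumes "quasi_geodesic K \<gamma>" "0 < K" "K \<le> K'" shows "quasi_geodesic K' \<gamma>"
  unfolding quasi_geodesic_def
proof (intro allI conjI)
  fix s t
  have "\<bar>real_of_int (s - t)\<bar> / K' \<le> \<bar>real_of_int (s - t)\<bar> / K"
    using assms by (intro divide_left_mono) auto
  then show "\<bar>real_of_int (s - t)\<bar> / K' - K' \<le> dist (\<gamma> s) (\<gamma> t)"
    using assms(1,3) unfolding quasi_geodesic_def by (smt (verit, best))
  have "K * \<bar>real_of_int (s - t)\<bar> \<le> K' * \<bar>real_of_int (s - t)\<bar>"
    using assms by (intro mult_right_mono) auto
  then show "dist (\<gamma> s) (\<gamma> t) \<le> K' * \<bar>real_of_int (s - t)\<bar> + K'"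
    using assms(1,3) unfolding quasi_geodesic_def by (smt (verit, best))
qed

lemma axis_translate:
  assumes "bij f" shows "zpow f k ` range (\<lambda>n. zpow f n x) = range (\<lambda>n. zpow f n x)"
proof -
  have "zpow f k ` range (\<lambda>n. zpow f n x) = range (\<lambda>n. zpow f (k + n) x)"
    by (simp add: image_image zpow_add[OF assms])
  also have "\<dots> = range (\<lambda>n. zpow f n x)"
    by (force simp: image_iff intro: exI[where x = "_ - k"])
  finally show ?thesis .
qed

text \<open>A projection from the axis of \<open>g\<close> to the axis of \<open>h\<close> stays
  within \<open>6 * K\<close> of the axis of \<open>g\<close>. Independence bounds its exponent, and
  the quasigeodesic upper bound turns this into a distance.\<close>

lemma axis_proj_bounded:
  fixes x0 :: "'a::metric_space"
  assumes geo: "geodesic_space TYPE('a)" and "0 < K"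
    and g: "contracting_set K (range (\<lambda>n. zpow g n x0))"
    and h: "contracting_set K (range (\<lambda>n. zpow h n x0))" "quasi_geodesic K (\<lambda>n. zpow h n x0)"
    and ind: "independent x0 g h"
  obtains D where "\<And>j a. a \<in> proj_set (range (\<lambda>n. zpow h n x0)) (zpow g j x0) \<Longrightarrow> dist x0 a \<le> D"
proof -
  obtain B :: int where B: "\<And>n m. dist (zpow g n x0) (zpow h m x0) < 6 * K + 1 \<Longrightarrow> \<bar>m\<bar> \<le> B"
    using ind \<open>0 < K\<close> unfolding independent_def by (metis add_pos_pos mult_pos_pos zero_less_numeral zero_less_one)
  have x0: "x0 \<in> range (\<lambda>n. zpow f n x0)" for f using zpow_0[of f] by (metis id_apply rangeI)
  have "dist x0 a \<le> K * of_int B + K" if a: "a \<in> proj_set (range (\<lambda>n. zpow h n x0)) (zpow g j x0)" for j a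
  proof -
    obtain n where n: "a = zpow h n x0" using proj_setD(1)[OF a] by auto
    obtain c where c: "c \<in> proj_set (range (\<lambda>n. zpow g n x0)) a" using contracting_set_nonempty[OF g] .
    obtain i where i: "c = zpow g i x0" using proj_setD(1)[OF c] by auto
    have "infdist a (range (\<lambda>n. zpow g n x0)) \<le> 6 * K"
      using proj_of_contracting_near[OF geo \<open>0 < K\<close> h(1) g x0 x0 _ a] by blast
    then have "\<bar>n\<bar> \<le> B" using B[of i n] proj_setD(2)[OF c] n i by (simp add: dist_commute)
    have "dist (zpow h 0 x0) (zpow h n x0) \<le> K * \<bar>real_of_int (0 - n)\<bar> + K"
      using h(2) unfolding quasi_geodesic_def by blast
    also have "K * \<bar>real_of_int (0 - n)\<bar> \<le> K * of_int B"
      using \<open>\<bar>n\<bar> \<le> B\<close> \<open>0 < K\<close> by (intro mult_left_mono) auto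
    finally show ?thesis using n by (simp add: zpow_0)
  qed
  then show ?thesis using that by blast
qed

locale independent_axes =
  fixes x0 :: "'a::metric_space" and g h :: "'a \<Rightarrow> 'a" and K :: real
  assumes geo: "geodesic_space TYPE('a)" and K_pos: "0 < K"
    and iso_g: "isometry g" and iso_h: "isometry h"
    and contr_g: "contracting_set K (range (\<lambda>n. zpow g n x0))"
    and contr_h: "contracting_set K (range (\<lambda>n. zpow h n x0))"
    and qg_g: "quasi_geodesic K (\<lambda>n. zpow g n x0)"
    and qg_h: "quasi_geodesic K (\<lambda>n. zpow h n x0)"
    and indep: "independent x0 g h"
begin

abbreviation axis where "axis \<equiv> range (\<lambda>n. zpow h n x0)"

lemma x0_axis: "x0 \<in> axis"
  using zpow_0[of h] by (metis id_apply rangeI)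

lemma zpow_g_cancel: "zpow g k (zpow g (- k) x) = x" "zpow g (- k) (zpow g k x) = x"
  using zpow_add[OF isometryD(1)[OF iso_g], of k "- k"] zpow_add[OF isometryD(1)[OF iso_g], of "- k" k]
  by (simp_all add: zpow_0 fun_eq_iff)

text \<open>The \<open>g\<close>-axis is invariant under \<open>zpow g k\<close>, so
  \<open>zpow g k y\<close> projects to it near \<open>zpow g k x0\<close>. If it projected far from
  \<open>x0\<close> on \<open>axis\<close>, the Behrstock inequality for the two axes would bring
  \<open>zpow g k x0\<close> near \<open>x0\<close>, which independence forbids for large
  exponents.\<close>

lemma translate_proj:
  "\<exists>N D. \<forall>k y a. N \<le> \<bar>k\<bar> \<longrightarrow> y \<in> axis \<longrightarrow> a \<in> proj_set axis (zpow g k y) \<longrightarrow> dist x0 a \<le> D"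
proof -
  let ?\<Gamma> = "range (\<lambda>n. zpow g n x0)"
  obtain D1 where D1: "\<And>j a. a \<in> proj_set axis (zpow g j x0) \<Longrightarrow> dist x0 a \<le> D1"
    using axis_proj_bounded[OF geo K_pos contr_g contr_h qg_h indep] by blast
  obtain D2 where D2: "\<And>j a. a \<in> proj_set ?\<Gamma> (zpow h j x0) \<Longrightarrow> dist x0 a \<le> D2"
    using axis_proj_bounded[OF geo K_pos contr_h contr_g qg_g independent_sym[OF indep]] by blast
  \<comment> \<open>Twice \<open>D2\<close> allows for the displacements of both \<open>c\<close>
    and \<open>c'\<close>; \<open>4 * K\<close> is the Behrstock bound.\<close>
  define M where "M = 4 * K + \<bar>D1\<bar> + 2 * \<bar>D2\<bar> + 1"
  have "0 < M" using K_pos by (simp add: M_def)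
  then obtain B :: int where B: "\<And>n m. dist (zpow g n x0) (zpow h m x0) < M \<Longrightarrow> \<bar>n\<bar> \<le> B"
    using indep unfolding independent_def by meson
  have "dist x0 a \<le> D1 + 2 * K"
    if k: "B + 1 \<le> \<bar>k\<bar>" and y: "y \<in> axis" and a: "a \<in> proj_set axis (zpow g k y)" for k y a
  proof (rule ccontr)
    assume far: "\<not> dist x0 a \<le> D1 + 2 * K"
    have gk: "M \<le> dist x0 (zpow g k x0)"
      using B[of k 0] k by (force simp: zpow_0 dist_commute not_less)
    obtain c0 where c0: "c0 \<in> proj_set ?\<Gamma> y" using contracting_set_nonempty[OF contr_g] .
    define c where "c = zpow g k c0"
    have c: "c \<in> proj_set ?\<Gamma> (zpow g k y)"
      using c0 proj_set_image_isometry[OF isometry_zpow[OF iso_g], of k ?\<Gamma> y]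
      by (auto simp: c_def axis_translate isometryD(1)[OF iso_g])
    have "dist x0 c0 \<le> D2" using D2 c0 y by auto
    then have dc: "dist (zpow g k x0) c \<le> D2"
      by (simp add: c_def isometryD(2)[OF isometry_zpow[OF iso_g]])
    obtain a' where a': "a' \<in> proj_set axis c" using contracting_set_nonempty[OF contr_h] .
    have da': "dist x0 a' \<le> D1" using D1 a' proj_setD(1)[OF c] by auto
    obtain c' where c': "c' \<in> proj_set ?\<Gamma> a" using contracting_set_nonempty[OF contr_g] .
    have dc': "dist x0 c' \<le> D2" using D2 c' proj_setD(1)[OF a] by auto
    have "2 * K < dist a a'" using far da' dist_triangle[of x0 a a'] by (simp add: dist_commute)
    moreover have "2 * K < dist c c'"
      using gk dc dc' K_pos dist_triangle[of x0 "zpow g k x0" c'] dist_triangle[of c' "zpow g k x0" c]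
      by (simp add: M_def dist_commute)
    ultimately have "infdist a ?\<Gamma> + infdist c axis \<le> 4 * K"
      using behrstock[OF geo _ contr_h contr_g a c a' c'] K_pos by simp
    then have "dist c a' \<le> 4 * K" using proj_setD(2)[OF a'] infdist_nonneg[of a ?\<Gamma>] by simp
    then show False
      using gk dc da' dist_triangle[of x0 "zpow g k x0" a'] dist_triangle[of a' "zpow g k x0" c]
      by (simp add: M_def dist_commute)
  qed
  then show ?thesis by blast
qed

text \<open>Two translates of \<open>axis\<close> by distant powers of \<open>g\<close> project
  boundedly to each other, so the Behrstock inequality lets a point project far from the base point
  on at most one of them.\<close>

lemma translates_behrstock:
  "\<exists>N D. 0 \<le> N \<and>
     (\<forall>k y a. N \<le> \<bar>k\<bar> \<longrightarrow> y \<in> axis \<longrightarrow> a \<in> proj_set axis (zpow g k y) \<longrightarrow> dist x0 a \<le> D) \<and>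
     (\<forall>k k' x. N \<le> \<bar>k' - k\<bar> \<longrightarrow>
       (\<forall>b\<in>proj_set axis (zpow g (- k) x). dist x0 b \<le> D) \<or>
       (\<forall>b\<in>proj_set axis (zpow g (- k') x). dist x0 b \<le> D))"
proof -
  obtain N0 :: int and D0 :: real where D0: "\<And>k y a. N0 \<le> \<bar>k\<bar> \<Longrightarrow> y \<in> axis \<Longrightarrow> a \<in> proj_set axis (zpow g k y) \<Longrightarrow> dist x0 a \<le> D0"
    using translate_proj by metis
  have "0 < 4 * K + \<bar>D0\<bar> + 1" using K_pos by simp
  then obtain B :: int where B: "\<And>n m. dist (zpow g n x0) (zpow h m x0) < 4 * K + \<bar>D0\<bar> + 1 \<Longrightarrow> \<bar>n\<bar> \<le> B"
    using indep unfolding independent_def by meson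
  define N where "N = max 0 (max N0 (B + 1))"
  have "(\<forall>b\<in>proj_set axis (zpow g (- k) x). dist x0 b \<le> D0 + 2 * K) \<or> (\<forall>b\<in>proj_set axis (zpow g (- k') x). dist x0 b \<le> D0 + 2 * K)"
    if N: "N \<le> \<bar>k' - k\<bar>" for k k' x
  proof (rule ccontr)
    assume neg: "\<not> ?thesis"
    \<comment> \<open>Applying \<open>zpow g (- k)\<close> reduces the claim to \<open>axis\<close>
      and its translate by \<open>zpow g j\<close>.\<close>
    define j where "j = k' - k"
    define y where "y = zpow g (- k) x"
    have yj: "zpow g (- k') x = zpow g (- j) y"
      unfolding y_def j_def using zpow_add[OF isometryD(1)[OF iso_g], of "- (k' - k)" "- k"] by simp
    obtain b r where b: "b \<in> proj_set axis y" "D0 + 2 * K < dist x0 b"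
      and r: "r \<in> proj_set axis (zpow g (- j) y)" "D0 + 2 * K < dist x0 r"
      using neg unfolding yj y_def[symmetric] by (auto simp: not_le)
    note iso = isometry_zpow[OF iso_g]
    let ?B = "zpow g j ` axis"
    have contr_B: "contracting_set K ?B" by (rule contracting_set_image_isometry[OF iso contr_h])
    have eq: "proj_set ?B z = zpow g j ` proj_set axis (zpow g (- j) z)" for z
      using proj_set_image_isometry[OF iso, of j axis "zpow g (- j) z"] by (simp add: zpow_g_cancel)
    have gr: "zpow g j r \<in> proj_set ?B y" using r eq by blast
    obtain a' where a': "a' \<in> proj_set axis (zpow g j r)" using contracting_set_nonempty[OF contr_h] .
    have da': "dist x0 a' \<le> D0" using D0 a' proj_setD(1)[OF r(1)] N by (auto simp: N_def j_def)
    obtain e where e: "e \<in> proj_set axis (zpow g (- j) b)" using contracting_set_nonempty[OF contr_h] .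
    have "N0 \<le> \<bar>- j\<bar>" using N by (auto simp: N_def j_def)
    then have de: "dist x0 e \<le> D0" by (rule D0[OF _ proj_setD(1)[OF b(1)] e])
    have ge: "zpow g j e \<in> proj_set ?B b" using e eq by blast
    have "2 * K < dist b a'" using b(2) da' dist_triangle[of x0 b a'] by (simp add: dist_commute)
    moreover have "2 * K < dist (zpow g j r) (zpow g j e)"
      using r(2) de dist_triangle[of x0 r e] by (simp add: dist_commute isometryD(2)[OF iso])
    ultimately have "infdist b ?B + infdist (zpow g j r) axis \<le> 4 * K"
      using behrstock[OF geo _ contr_h contr_B b(1) gr a' ge] K_pos by simp
    then have "dist b (zpow g j e) \<le> 4 * K"
      using proj_setD(2)[OF ge] infdist_nonneg[of "zpow g j r" axis] by simp
    moreover have "dist (zpow g j x0) (zpow g j e) \<le> D0" using de by (simp add: isometryD(2)[OF iso])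
    ultimately have near: "dist (zpow g j x0) b < 4 * K + \<bar>D0\<bar> + 1"
      using dist_triangle2[of "zpow g j x0" b "zpow g j e"] by simp
    obtain n where "b = zpow h n x0" using proj_setD(1)[OF b(1)] by auto
    then show False using B[of j n] near N by (auto simp: N_def j_def)
  qed
  moreover have "dist x0 a \<le> D0 + 2 * K" if "N \<le> \<bar>k\<bar>" "y \<in> axis" "a \<in> proj_set axis (zpow g k y)" for k y a
    using D0[of k y a] that K_pos by (auto simp: N_def)
  moreover have "0 \<le> N" by (simp add: N_def)
  ultimately show ?thesis by (metis (no_types, lifting))
qed

text \<open>\<open>L i x\<close> says that \<open>x\<close> projects near the base point of the axis
  translated by \<open>g ^^ (M * (i + 1))\<close>, and \<open>R i y\<close> that \<open>y\<close>,
  moved by \<open>g ^^ (M * (5 - i))\<close>, projects near \<open>x0\<close>. Each fails for at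
  most one \<open>i\<close> by the Behrstock alternative. The middle factor \<open>h ^^ m\<close>
  separates the two projections, so \<open>far_projections\<close> gives the last bound. The
  exponents of \<open>g\<close> always add up to \<open>6 * M\<close>, which makes the word lengths
  equal.\<close>

lemma schottky_family:
  obtains M m :: nat and L R :: "nat \<Rightarrow> 'a \<Rightarrow> bool" and C :: real
    and s :: "nat \<Rightarrow> 'a \<Rightarrow> 'a"
  where "\<And>i. s i = (g ^^ (M * (i + 1))) \<circ> (h ^^ m) \<circ> (g ^^ (M * (5 - i)))"
    and "0 < M"
    and "inj_on s {..<5}"
    and "\<And>i j x. i < 5 \<Longrightarrow> j < 5 \<Longrightarrow> \<not> L i x \<Longrightarrow> \<not> L j x \<Longrightarrow> i = j"
    and "\<And>i j x. i < 5 \<Longrightarrow> j < 5 \<Longrightarrow> \<not> R i x \<Longrightarrow> \<not> R j x \<Longrightarrow> i = j"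
    and "\<And>i x y. i < 5 \<Longrightarrow> L i x \<Longrightarrow> R i y \<Longrightarrow> dist x x0 + dist x0 y - C \<le> dist x (s i y)"
proof -
  obtain N :: int and D :: real where "0 \<le> N"
    and D: "\<And>k y a. N \<le> \<bar>k\<bar> \<Longrightarrow> y \<in> axis \<Longrightarrow> a \<in> proj_set axis (zpow g k y) \<Longrightarrow> dist x0 a \<le> D"
    and behr: "\<And>k k' x. N \<le> \<bar>k' - k\<bar> \<Longrightarrow>
       (\<forall>b\<in>proj_set axis (zpow g (- k) x). dist x0 b \<le> D) \<or> (\<forall>b\<in>proj_set axis (zpow g (- k') x). dist x0 b \<le> D)"
    using translates_behrstock by metis
  have bij: "bij g" "bij h" using isometryD(1)[OF iso_g] isometryD(1)[OF iso_h] .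
  \<comment> \<open>Distinct multiples of \<open>M\<close> differ by at least \<open>N\<close>;
    adding 1 keeps \<open>M\<close> positive.\<close>
  define M where "M = nat N + 1"
  define kl where "kl i = int (M * i)" for i
  \<comment> \<open>Solves the lower quasigeodesic bound \<open>m / K - K\<close> for a displacement
    above \<open>2 * D + 2 * K\<close>.\<close>
  define m where "m = nat \<lceil>K * (2 * D + 2 * K + K + 1)\<rceil>"
  define t where "t = zpow h (int m)"
  define s where "s i = (g ^^ (M * (i + 1))) \<circ> (h ^^ m) \<circ> (g ^^ (M * (5 - i)))" for i
  have s_eq: "s i = zpow g (kl (i + 1)) \<circ> t \<circ> zpow g (kl (5 - i))" for i
    by (simp only: s_def kl_def t_def zpow_of_nat)
  have sep: "N \<le> \<bar>kl i - kl j\<bar>" if "i \<noteq> j" for i j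
  proof -
    have "1 \<le> \<bar>int i - int j\<bar>" using that by simp
    then have "int M * 1 \<le> int M * \<bar>int i - int j\<bar>" by (intro mult_left_mono) auto
    moreover have "kl i - kl j = int M * (int i - int j)" by (simp add: kl_def algebra_simps)
    then have "\<bar>kl i - kl j\<bar> = int M * \<bar>int i - int j\<bar>" by (simp add: abs_mult)
    ultimately have "int M \<le> \<bar>kl i - kl j\<bar>" by linarith
    moreover have "N \<le> int M" by (simp add: M_def)
    ultimately show ?thesis by linarith
  qed
  have iso_t: "isometry t" unfolding t_def by (rule isometry_zpow[OF iso_h])
  have far: "2 * D + 2 * K < dist x0 (t x0)"
  proof -
    have "K * (2 * D + 2 * K + K + 1) \<le> real m" unfolding m_def by linarith
    then have "2 * D + 2 * K + K + 1 \<le> real m / K"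
      using K_pos by (simp add: pos_le_divide_eq mult.commute)
    moreover have "\<bar>real_of_int (0 - int m)\<bar> / K - K \<le> dist (zpow h 0 x0) (zpow h (int m) x0)"
      using qg_h unfolding quasi_geodesic_def by blast
    ultimately show ?thesis by (simp add: t_def zpow_0)
  qed
  have proj_t: "proj_set axis (t y) = t ` proj_set axis y" for y
    using proj_set_image_isometry[OF iso_t, of axis y] axis_translate[OF bij(2)] by (simp add: t_def)
  have t_axis: "t x0 \<in> axis" unfolding t_def by blast
  define L where "L i x \<longleftrightarrow> (\<forall>b\<in>proj_set axis (zpow g (- kl (i + 1)) x). dist x0 b \<le> D)" for i x
  define R where "R i y \<longleftrightarrow> (\<forall>b\<in>proj_set axis (zpow g (kl (5 - i)) y). dist x0 b \<le> D)" for i y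
  show ?thesis
  proof (rule that[of s M m L R])
    show "s i = (g ^^ (M * (i + 1))) \<circ> (h ^^ m) \<circ> (g ^^ (M * (5 - i)))" for i
      by (rule s_def)
    show "0 < M" by (simp add: M_def)
    show "i = j" if "i < 5" "j < 5" "\<not> L i x" "\<not> L j x" for i j x
      using behr[of "kl (i + 1)" "kl (j + 1)" x] sep[of "i + 1" "j + 1"] that unfolding L_def by fastforce
    show "i = j" if "i < 5" "j < 5" "\<not> R i x" "\<not> R j x" for i j x
    proof (rule ccontr)
      assume "i \<noteq> j"
      then have "N \<le> \<bar>- kl (5 - i) - - kl (5 - j)\<bar>" using sep[of "5 - j" "5 - i"] that by simp
      then show False using behr[of "- kl (5 - i)" "- kl (5 - j)" x] that unfolding R_def minus_minus by blast
    qed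
    \<comment> \<open>The displacements caused by the powers of \<open>g\<close> are summed over all
      \<open>i\<close>, so that one constant serves the five elements.\<close>
    show "dist x x0 + dist x0 y -
        (2 * D + 2 * K + (\<Sum>i<5. dist x0 (zpow g (kl (i + 1)) x0) + dist x0 (zpow g (kl (5 - i)) x0)))
        \<le> dist x (s i y)" if i: "i < 5" and l: "L i x" and r: "R i y" for i x y
    proof -
      define x' y' where "x' = zpow g (- kl (i + 1)) x" and "y' = zpow g (kl (5 - i)) y"
      obtain a where a: "a \<in> proj_set axis x'" using contracting_set_nonempty[OF contr_h] .
      obtain b where b: "b \<in> proj_set axis y'" using contracting_set_nonempty[OF contr_h] .
      have tb: "t b \<in> proj_set axis (t y')" using b proj_t by blast
      have da: "dist x0 a \<le> D" using l a by (auto simp: L_def x'_def)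
      have db: "dist x0 b \<le> D" using r b by (auto simp: R_def y'_def)
      have "dist (t x0) (t b) \<le> D" using db by (simp add: isometryD(2)[OF iso_t])
      then have "2 * K < dist a (t b)"
        using far da dist_triangle[of x0 "t x0" "t b"] dist_triangle[of x0 "t b" a] by (simp add: dist_commute)
      then have "dist x' a + dist (t y') (t b) - 2 * K \<le> dist x' (t y')"
        using far_projections[OF geo contr_h _ a tb] K_pos proj_setD(2)[OF a] proj_setD(2)[OF tb] by simp
      then have 1: "dist x' x0 + dist y' x0 - 2 * D - 2 * K \<le> dist x' (t y')"
        using da db dist_triangle2[of x' x0 a] dist_triangle2[of y' x0 b] by (simp add: isometryD(2)[OF iso_t])
      note iso = isometryD(2)[OF isometry_zpow[OF iso_g]]
      have 2: "dist x (s i y) = dist x' (t y')"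
        using iso[of "kl (i + 1)" x' "t y'"] by (simp add: s_eq x'_def y'_def zpow_g_cancel)
      have "dist x' x0 = dist x (zpow g (kl (i + 1)) x0)"
        using iso[of "kl (i + 1)" x' x0] by (simp add: x'_def zpow_g_cancel)
      then have 3: "dist x x0 - dist x0 (zpow g (kl (i + 1)) x0) \<le> dist x' x0"
        using dist_triangle2[of x x0 "zpow g (kl (i + 1)) x0"] by simp
      have "dist y' (zpow g (kl (5 - i)) x0) = dist y x0" by (simp add: y'_def iso)
      then have 4: "dist x0 y - dist x0 (zpow g (kl (5 - i)) x0) \<le> dist y' x0"
        using dist_triangle[of y' "zpow g (kl (5 - i)) x0" x0] by (simp add: dist_commute)
      have "dist x0 (zpow g (kl (i + 1)) x0) + dist x0 (zpow g (kl (5 - i)) x0)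
          \<le> (\<Sum>i<5. dist x0 (zpow g (kl (i + 1)) x0) + dist x0 (zpow g (kl (5 - i)) x0))"
        by (rule member_le_sum) (use i in auto)
      with 1 2 3 4 show ?thesis by simp
    qed
    show "inj_on s {..<5}"
    proof (rule inj_onI, rule ccontr)
      fix i j assume "i \<in> {..<5}" "j \<in> {..<5}" and eq: "s i = s j" and "i \<noteq> j"
      define e where "e = kl (j + 1) - kl (i + 1)"
      have e: "N \<le> \<bar>- e\<bar>" using sep[of "j + 1" "i + 1"] \<open>i \<noteq> j\<close> by (simp add: e_def)
      have e': "e = kl (5 - i) - kl (5 - j)"
      proof -
        have "int (5 - i) = 5 - int i" "int (5 - j) = 5 - int j"
          using \<open>i \<in> {..<5}\<close> \<open>j \<in> {..<5}\<close> by auto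
        then show ?thesis by (simp add: e_def kl_def algebra_simps)
      qed
      have "s i (zpow g (- kl (5 - i)) x0) = zpow g (kl (i + 1)) (t x0)"
        by (simp add: s_eq zpow_g_cancel)
      moreover have "s j (zpow g (- kl (5 - i)) x0) = zpow g (kl (j + 1)) (t (zpow g (- e) x0))"
        using zpow_add[OF bij(1), of "kl (5 - j)" "- kl (5 - i)"] by (simp add: s_eq e')
      ultimately have "zpow g (kl (i + 1)) (t x0) = zpow g (kl (j + 1)) (t (zpow g (- e) x0))"
        using eq by simp
      then have "zpow g (- kl (j + 1)) (zpow g (kl (i + 1)) (t x0)) = t (zpow g (- e) x0)"
        by (simp only: zpow_g_cancel)
      \<comment> \<open>The common point lies on a translated axis, so it projects within
        \<open>D\<close> of \<open>x0\<close>. As the \<open>t\<close>-image of another such point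
        it also projects within \<open>D\<close> of \<open>t x0\<close>. By \<open>far\<close> these
        are incompatible.\<close>
      then have comm: "zpow g (- e) (t x0) = t (zpow g (- e) x0)"
        using zpow_add[OF bij(1), of "- kl (j + 1)" "kl (i + 1)"] by (simp add: e_def)
      obtain a where a: "a \<in> proj_set axis (zpow g (- e) x0)" using contracting_set_nonempty[OF contr_h] .
      have "dist (t x0) (t a) \<le> D" using D[OF e x0_axis a] by (simp add: isometryD(2)[OF iso_t])
      moreover have "t a \<in> proj_set axis (zpow g (- e) (t x0))" using a proj_t comm by auto
      then have "dist x0 (t a) \<le> D" by (rule D[OF e t_axis])
      ultimately show False using far K_pos dist_triangle2[of x0 "t x0" "t a"] by simp
    qed
  qed
qed

end

section \<open>A recursive inequality with windows\<close>

lemma exp_dominates_linear: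
  fixes E x :: real
  assumes "exp 1 \<le> 2 * E" "1 \<le> x"
  shows "2 * E * x \<le> exp (ln (2 * E) * x)"
proof -
  have "0 < 2 * E" using assms(1) exp_gt_zero[of "1 :: real"] by linarith
  have B: "1 \<le> ln (2 * E)" using assms(1) \<open>0 < 2 * E\<close> by (simp add: ln_ge_iff)
  have "x \<le> 1 + (x - 1)" by simp
  also have "\<dots> \<le> exp (x - 1)" by (rule exp_ge_add_one_self)
  also have "x - 1 \<le> ln (2 * E) * (x - 1)" using mult_right_mono[OF B, of "x - 1"] assms(2) by simp
  finally have "x \<le> exp (ln (2 * E) * (x - 1))" by simp
  then have "(2 * E) * x \<le> exp (ln (2 * E)) * exp (ln (2 * E) * (x - 1))"
    using \<open>0 < 2 * E\<close> assms(2) by (intro mult_mono) auto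
  also have "\<dots> = exp (ln (2 * E) * x)" by (simp add: exp_add[symmetric] algebra_simps)
  finally show ?thesis .
qed

text \<open>With \<open>x = n / N\<close>, the induction carries the factor
  \<open>D n = exp (B * x) / (E * x)\<close>. A product of two such factors has the square of
  \<open>E * x\<close> in its denominator, and this pays for summing over the window, whose size is
  linear in \<open>x\<close>. The rate drops from \<open>A\<close> to \<open>A - ln (2 * E)\<close>,
  a loss only logarithmic in \<open>A\<close>.\<close>

lemma subadditive_window_decay:
  fixes \<phi> :: "nat \<Rightarrow> real" and A \<rho> c :: real and q N :: nat
  defines "E \<equiv> 36 * (1 + A / \<rho>)"
  assumes A: "0 < A" and \<rho>: "0 < \<rho>" and q: "0 < q" and nonneg: "\<And>n. 0 \<le> \<phi> n"
    and rec: "\<And>a b m. \<phi> (a + m * q + b) \<le> c * (\<Sum>i<m. \<phi> (a + i * q) * \<phi> ((m - Suc i) * q + b)) + exp (- \<rho> * real m)"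
    and c: "0 \<le> c" "c * exp (A * real q / real N) \<le> 2"
    and N: "12 \<le> N" "8 * q \<le> N" "8 * real q * (A / \<rho>) \<le> real N"
    and base: "\<And>n. N \<le> n \<Longrightarrow> n \<le> 4 * N \<Longrightarrow> \<phi> n \<le> 2 * exp (- A * (real n / real N))"
    and "N \<le> n"
  shows "\<phi> n \<le> exp ((ln (2 * E) - A) * (real n / real N))"
proof -
  define B where "B = ln (2 * E)"
  define D where "D n = exp (B * (real n / real N)) / (E * (real n / real N))" for n
  have N0: "0 < real N" using N(1) by simp
  have "0 \<le> A / \<rho>" using A \<rho> by simp
  then have E: "36 \<le> E" by (simp add: E_def)
  have dom: "2 * E * x \<le> exp (B * x)" if "1 \<le> x" for x
    unfolding B_def using that exp_le E by (intro exp_dominates_linear) auto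
  \<comment> \<open>Absorbs the factor 2 of the base range, and later the error term into half of
    \<open>D n\<close>.\<close>
  have D2: "2 \<le> D n" if "N \<le> n" for n
  proof -
    have x: "1 \<le> real n / real N" using that N0 by simp
    then have "0 < E * (real n / real N)" using E by (intro mult_pos_pos) auto
    then show ?thesis unfolding D_def using dom[OF x] by (subst pos_le_divide_eq) (simp_all add: mult.assoc)
  qed
  have main: "N \<le> n \<longrightarrow> \<phi> n \<le> D n * exp (- A * (real n / real N))" for n
  proof (induction n rule: less_induct)
    case (less n)
    show ?case
    proof
      assume "N \<le> n"
      define x where "x = real n / real N"
      have x: "1 \<le> x" using \<open>N \<le> n\<close> N0 by (simp add: x_def)
      show "\<phi> n \<le> D n * exp (- A * (real n / real N))"
      proof (cases "n \<le> 4 * N")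
        case True
        have "\<phi> n \<le> 2 * exp (- A * (real n / real N))" using base \<open>N \<le> n\<close> True by simp
        also have "\<dots> \<le> D n * exp (- A * (real n / real N))"
          using D2[OF \<open>N \<le> n\<close>] by (intro mult_right_mono) auto
        finally show ?thesis .
      next
        case False
        \<comment> \<open>The shortest window whose error \<open>exp (- \<rho> * m)\<close> is at
          most \<open>exp (- A * x)\<close>.\<close>
        define m where "m = nat \<lceil>A * x / \<rho>\<rceil>"
        have m_ge: "A * x / \<rho> \<le> real m" unfolding m_def by linarith
        have "0 \<le> A * x / \<rho>" using A \<rho> x by simp
        then have m_le: "real m \<le> 1 + A * x / \<rho>" unfolding m_def by linarith
        have mq: "real (m * q) \<le> real n / 4"
        proof -
          have "real (m * q) \<le> (1 + A * x / \<rho>) * real q" using m_le by (simp add: mult_right_mono)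
          also have "\<dots> = real q + (real q * (A / \<rho>)) * x" by (simp add: algebra_simps)
          also have "\<dots> \<le> real n / 8 + (real N / 8) * x"
          proof (intro add_mono mult_right_mono)
            show "real q \<le> real n / 8" using N(2) \<open>N \<le> n\<close> by linarith
            have "8 * (real q * (A / \<rho>)) \<le> real N" using N(3) by (simp only: mult.assoc)
            then show "real q * (A / \<rho>) \<le> real N / 8" by linarith
          qed (use x in simp)
          also have "\<dots> = real n / 4" using N0 by (simp add: x_def)
          finally show ?thesis .
        qed
        define a where "a = (n - m * q) div 2"
        define b where "b = n - m * q - a"
        have mqn: "m * q \<le> n" using mq by linarith
        have n_eq: "n = a + m * q + b" using mqn by (simp add: a_def b_def)
        have ab: "n \<le> 3 * a" "n \<le> 3 * b"
        proof -
          have "4 * (m * q) \<le> n" using mq by linarith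
          \<comment> \<open>At least three quarters of \<open>n\<close> remain outside the window;
            12 pays for rounding when they are halved.\<close>
          moreover have "12 \<le> n" using \<open>N \<le> n\<close> N(1) by linarith
          ultimately show "n \<le> 3 * a" "n \<le> 3 * b" unfolding a_def b_def by linarith+
        qed
        have summand: "\<phi> (a + i * q) * \<phi> ((m - Suc i) * q + b) \<le>
            9 * exp (B * x) / (E * x)\<^sup>2 * (exp (A * real q / real N) * exp (- A * x))" if i: "i < m" for i
        proof -
          define l r where "l = a + i * q" and "r = (m - Suc i) * q + b"
          obtain d where d: "m = Suc i + d" using less_imp_Suc_add[OF i] by auto
          \<comment> \<open>The block at the cut is lost, at the price of the factor
            \<open>exp (A * q / N)\<close> that the hypothesis on \<open>c\<close> absorbs.\<close>
          have lr: "l + r + q = n" unfolding n_eq l_def r_def by (simp add: d algebra_simps)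
          have l3: "n \<le> 3 * l" and r3: "n \<le> 3 * r" using ab by (simp_all add: l_def r_def)
          have ln: "l < n" "r < n" using lr q by auto
          have lN: "N \<le> l" "N \<le> r" using l3 r3 False by linarith+
          have "\<phi> l \<le> D l * exp (- A * (real l / real N))" "\<phi> r \<le> D r * exp (- A * (real r / real N))"
            using less ln lN by blast+
          moreover have Dp: "0 \<le> D k" for k using E by (simp add: D_def)
          ultimately have "\<phi> l * \<phi> r \<le> (D l * exp (- A * (real l / real N))) * (D r * exp (- A * (real r / real N)))"
            using nonneg by (intro mult_mono) auto
          also have "\<dots> = (D l * D r) * exp (- A * ((real l + real r) / real N))"
            by (simp add: exp_add[symmetric] add_divide_distrib algebra_simps)
          also have "(real l + real r) / real N = x - real q / real N"
            using lr by (simp add: x_def diff_divide_distrib[symmetric] flip: lr)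
          also have "exp (- A * (x - real q / real N)) = exp (A * real q / real N) * exp (- A * x)"
            by (simp add: exp_add[symmetric] algebra_simps)
          also have "D l * D r \<le> 9 * exp (B * x) / (E * x)\<^sup>2"
          proof -
            have pos: "0 < E * x / 3" using E x by simp
            have 1: "E * x / 3 \<le> E * (real l / real N)" "E * x / 3 \<le> E * (real r / real N)"
              using E l3 r3 N0 by (simp_all add: x_def divide_simps)
            have "0 < B" unfolding B_def using E by simp
            have "D l * D r = exp (B * ((real l + real r) / real N)) / ((E * (real l / real N)) * (E * (real r / real N)))"
              by (simp add: D_def exp_add[symmetric] add_divide_distrib algebra_simps)
            also have "\<dots> \<le> exp (B * x) / ((E * x / 3) * (E * x / 3))"
            proof (intro frac_le mult_mono 1)
              have "(real l + real r) / real N \<le> x" using lr N0 by (simp add: x_def divide_right_mono)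
              then show "exp (B * ((real l + real r) / real N)) \<le> exp (B * x)"
                using \<open>0 < B\<close> by (subst exp_le_cancel_iff) (rule mult_left_mono, auto)
            qed (use pos E in auto)
            also have "\<dots> = 9 * exp (B * x) / (E * x)\<^sup>2" by (simp add: power2_eq_square)
            finally show ?thesis .
          qed
          finally show ?thesis by (simp add: l_def r_def mult_right_mono)
        qed
        have "\<phi> n \<le> c * (\<Sum>i<m. \<phi> (a + i * q) * \<phi> ((m - Suc i) * q + b)) + exp (- \<rho> * real m)"
          unfolding n_eq by (rule rec)
        also have "\<dots> \<le> c * (\<Sum>i<m. 9 * exp (B * x) / (E * x)\<^sup>2 * (exp (A * real q / real N) * exp (- A * x))) + exp (- A * x)"
        proof (intro add_mono mult_left_mono sum_mono summand c(1))
          show "exp (- \<rho> * real m) \<le> exp (- A * x)"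
            using m_ge \<rho> by (simp add: pos_divide_le_eq mult.commute)
        qed auto
        also have "\<dots> = ((c * exp (A * real q / real N)) * (real m * (9 * exp (B * x) / (E * x)\<^sup>2)) + 1) * exp (- A * x)"
          by (simp add: algebra_simps)
        also have "\<dots> \<le> D n * exp (- A * x)"
        proof (intro mult_right_mono)
          have Ex: "0 < E * x" using E x by simp
          \<comment> \<open>The 36 is 2 from the bound on \<open>c\<close>, 9 from the two thirds in
            \<open>D l * D r\<close>, and 2 to reach half of \<open>D n\<close>.\<close>
          have "36 * real m \<le> 36 * (1 + A * x / \<rho>)" using m_le by simp
          also have "\<dots> \<le> E * x" using x by (simp add: E_def algebra_simps)
          finally have mE: "36 * real m \<le> E * x" .
          have "(c * exp (A * real q / real N)) * (real m * (9 * exp (B * x) / (E * x)\<^sup>2)) \<le> 2 * (real m * (9 * exp (B * x) / (E * x)\<^sup>2))"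
            using c by (intro mult_right_mono) auto
          also have "\<dots> = (36 * real m) * (exp (B * x) / (2 * (E * x)\<^sup>2))" by simp
          also have "\<dots> \<le> (E * x) * (exp (B * x) / (2 * (E * x)\<^sup>2))" by (intro mult_right_mono mE) auto
          also have "\<dots> = D n / 2" using Ex by (simp add: D_def x_def[symmetric] power2_eq_square)
          finally show "(c * exp (A * real q / real N)) * (real m * (9 * exp (B * x) / (E * x)\<^sup>2)) + 1 \<le> D n"
            using D2[OF \<open>N \<le> n\<close>] by simp
        qed auto
        finally show ?thesis by (simp add: x_def)
      qed
    qed
  qed
  have x: "1 \<le> real n / real N" using \<open>N \<le> n\<close> N0 by simp
  have "1 \<le> E * (real n / real N)" using mult_mono[of 1 E 1 "real n / real N"] E x by simp
  then have "D n \<le> exp (B * (real n / real N))"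
    unfolding D_def
    by (subst pos_divide_le_eq) (use mult_left_mono[of 1 "E * (real n / real N)" "exp (B * (real n / real N))"] in auto)
  then have "D n * exp (- A * (real n / real N)) \<le> exp (B * (real n / real N)) * exp (- A * (real n / real N))"
    by (rule mult_right_mono) simp
  with main \<open>N \<le> n\<close> have "\<phi> n \<le> exp (B * (real n / real N)) * exp (- A * (real n / real N))"
    by (meson order_trans)
  then show ?thesis by (simp add: B_def exp_add[symmetric] algebra_simps)
qed

text \<open>The order of choices matters: first \<open>A\<close>, depending on \<open>L\<close>,
  \<open>L'\<close> and \<rho>, then the scale \<open>N\<close>, and last
  \<open>t = A / (L' * N)\<close>, for which \<open>t * L' * n\<close> equals
  \<open>A * n / N\<close>.\<close>

lemma exponential_decay:
  fixes \<phi> :: "real \<Rightarrow> nat \<Rightarrow> real" and C \<delta> L L' :: real and p :: "nat \<Rightarrow> real" and q :: nat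
  assumes q: "0 < q" and \<delta>: "\<delta> < 1" and L: "0 < L" "L < L'"
    and nonneg: "\<And>t n. 0 \<le> \<phi> t n"
    and rec: "\<And>t a b m. 0 \<le> t \<Longrightarrow>
      \<phi> t (a + m * q + b) \<le> exp (t * C) * (\<Sum>i<m. \<phi> t (a + i * q) * \<phi> t ((m - Suc i) * q + b)) + \<delta> ^ m"
    and base: "\<And>t n. 0 \<le> t \<Longrightarrow> \<phi> t n \<le> exp (- t * L' * real n) + p n"
    and p: "p \<longlonglongrightarrow> 0" and \<delta>0: "0 \<le> \<delta>"
  obtains t \<theta> N where "0 < t" "0 < \<theta>" "\<And>n. N \<le> n \<Longrightarrow> exp (t * L * real n) * \<phi> t n \<le> exp (- \<theta> * real n)"
proof -
  \<comment> \<open>The maximum with 1/2 keeps the argument of the logarithm positive.\<close>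
  define \<delta>' where "\<delta>' = max \<delta> (1 / 2)"
  define \<rho> where "\<rho> = - ln \<delta>'"
  have \<delta>': "0 < \<delta>'" "\<delta>' < 1" "\<delta> \<le> \<delta>'" using \<delta> by (auto simp: \<delta>'_def)
  have \<rho>: "0 < \<rho>" using \<delta>' by (simp add: \<rho>_def)
  have pow: "\<delta> ^ m \<le> exp (- \<rho> * real m)" for m
  proof -
    have "\<delta> ^ m \<le> \<delta>' ^ m" using \<delta>' \<delta>0 by (intro power_mono) auto
    also have "\<dots> = exp (- \<rho> * real m)" using \<delta>' by (simp add: \<rho>_def exp_of_nat2_mult)
    finally show ?thesis .
  qed
  have "0 < 1 - L / L'" using L by simp
  \<comment> \<open>The gain from \<open>L < L'\<close> is linear in \<open>A\<close> and beats the
    logarithmic loss.\<close>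
  then have "eventually (\<lambda>A. 0 < A * (1 - L / L') - ln (2 * (36 * (1 + A / \<rho>)))) at_top"
    using \<rho> by real_asymp
  then have "eventually (\<lambda>A. 0 < A \<and> 0 < A * (1 - L / L') - ln (2 * (36 * (1 + A / \<rho>)))) at_top"
    using eventually_gt_at_top[of "0 :: real"] by eventually_elim simp
  then obtain A where A: "0 < A" and gain: "0 < A * (1 - L / L') - ln (2 * (36 * (1 + A / \<rho>)))"
    by (auto simp: eventually_at_top_linorder)
  \<comment> \<open>\<open>M / N\<close> is the exponent of the whole price of one cut: the
    alignment defect and the lost block.\<close>
  define M where "M = (A * C / L' + A * real q)"
  have lim: "(\<lambda>N. exp (M / real N)) \<longlonglongrightarrow> 1" by real_asymp
  have "eventually (\<lambda>N. exp (M / real N) < 2) sequentially"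
    using lim by (rule order_tendstoD) simp
  \<comment> \<open>\<open>exp (- A * 4)\<close> is the smallest value of
    \<open>exp (- A * (n / N))\<close> for \<open>n\<close> between \<open>N\<close> and
    \<open>4 * N\<close>.\<close>
  moreover have "eventually (\<lambda>N. p N < exp (- A * 4)) sequentially"
    using p by (rule order_tendstoD) simp
  ultimately obtain N1 where N1: "\<And>N. N1 \<le> N \<Longrightarrow> exp (M / real N) < 2"
      "\<And>N. N1 \<le> N \<Longrightarrow> p N < exp (- A * 4)"
    unfolding eventually_sequentially by (metis nat_le_linear order_trans)
  define N where "N = max N1 (max 12 (max (8 * q) (nat \<lceil>8 * real q * (A / \<rho>)\<rceil>)))"
  have N: "N1 \<le> N" "12 \<le> N" "8 * q \<le> N" by (auto simp: N_def)
  have N4: "8 * real q * (A / \<rho>) \<le> real N" unfolding N_def by linarith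
  have N0: "0 < real N" using N(2) by simp
  define t where "t = A / (L' * real N)"
  have t: "0 < t" using A L N0 by (simp add: t_def)
  have tL': "t * L' = A / real N" using L by (simp add: t_def)
  have decay: "\<phi> t n \<le> exp ((ln (2 * (36 * (1 + A / \<rho>))) - A) * (real n / real N))" if "N \<le> n" for n
  proof (rule subadditive_window_decay[OF A \<rho> q nonneg _ _ _ N(2,3) N4 _ that])
    show "\<phi> t (a + m * q + b) \<le> exp (t * C) * (\<Sum>i<m. \<phi> t (a + i * q) * \<phi> t ((m - Suc i) * q + b)) + exp (- \<rho> * real m)" for a b m
      using rec[of t a m b] pow[of m] t by simp
    have "exp (t * C) * exp (A * real q / real N) = exp (M / real N)"
      by (simp add: M_def t_def exp_add[symmetric] add_divide_distrib)
    then show "exp (t * C) * exp (A * real q / real N) \<le> 2" using N1(1)[OF N(1)] by simp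
    show "\<phi> t k \<le> 2 * exp (- A * (real k / real N))" if k: "N \<le> k" "k \<le> 4 * N" for k
    proof -
      have "p k \<le> exp (- A * 4)" using N1(2)[of k] k N(1) by simp
      also have "\<dots> \<le> exp (- A * (real k / real N))" using A k N0 by (simp add: pos_divide_le_eq)
      finally show ?thesis using base[of t k] t tL' by (simp add: mult.assoc[symmetric])
    qed
  qed simp
  define \<theta> where "\<theta> = (A * (1 - L / L') - ln (2 * (36 * (1 + A / \<rho>)))) / real N"
  have "exp (t * L * real n) * \<phi> t n \<le> exp (- \<theta> * real n)" if "N \<le> n" for n
  proof -
    have "exp (t * L * real n) * \<phi> t n \<le> exp (t * L * real n) * exp ((ln (2 * (36 * (1 + A / \<rho>))) - A) * (real n / real N))"
      by (intro mult_left_mono decay that) simp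
    also have "\<dots> = exp (- \<theta> * real n)"
      using L N0 unfolding exp_add[symmetric] by (simp add: \<theta>_def t_def field_simps)
    finally show ?thesis .
  qed
  moreover have "0 < \<theta>" using gain N0 by (simp add: \<theta>_def)
  ultimately show ?thesis using that t by blast
qed

section \<open>Laplace transform of the walk\<close>

lemma walk_law_add:
  "walk_law \<mu> (m + n) = bind_pmf (walk_law \<mu> m) (\<lambda>u. map_pmf (\<lambda>v. u \<circ> v) (walk_law \<mu> n))"
proof (induction n)
  case 0
  then show ?case by (simp add: bind_return_pmf')
next
  case (Suc n)
  then show ?case by (simp add: map_pmf_def bind_assoc_pmf bind_return_pmf comp_def)
qed

lemma nn_integral_walk_law_add:
  "(\<integral>\<^sup>+ w. f w \<partial>walk_law \<mu> (m + n)) = (\<integral>\<^sup>+ u. \<integral>\<^sup>+ v. f (u \<circ> v) \<partial>walk_law \<mu> n \<partial>walk_law \<mu> m)"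
  by (simp add: walk_law_add)

lemma walk_law_mult:
  "walk_law \<mu> (m * q) = map_pmf (\<lambda>gs. foldr (\<circ>) gs id) (replicate_pmf m (walk_law \<mu> q))"
proof (induction m)
  case 0
  then show ?case by (simp add: id_def)
next
  case (Suc m)
  have "walk_law \<mu> (Suc m * q) = walk_law \<mu> (q + m * q)" by simp
  then show ?case
    by (simp only: walk_law_add Suc) (simp add: map_pmf_def bind_assoc_pmf bind_return_pmf comp_def id_def)
qed

lemma isometry_walk_law:
  assumes "\<And>g. g \<in> set_pmf \<mu> \<Longrightarrow> isometry g" "w \<in> set_pmf (walk_law \<mu> n)"
  shows "isometry w"
  using assms(2) by (induction n arbitrary: w) (auto simp: isometry_id intro: isometry_comp assms(1))

lemma nn_integral_pmf_swap:
  "(\<integral>\<^sup>+ x. \<integral>\<^sup>+ y. f x y \<partial>measure_pmf q \<partial>measure_pmf p) = (\<integral>\<^sup>+ y. \<integral>\<^sup>+ x. f x y \<partial>measure_pmf p \<partial>measure_pmf q)"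
proof -
  have "(\<integral>\<^sup>+ x. \<integral>\<^sup>+ y. f x y \<partial>q \<partial>p) = (\<integral>\<^sup>+ z. f (fst z) (snd z) \<partial>pair_pmf p q)"
    by (simp add: nn_integral_pair_pmf')
  also have "\<dots> = (\<integral>\<^sup>+ y. \<integral>\<^sup>+ x. f x y \<partial>p \<partial>q)"
    by (subst pair_commute_pmf) (simp add: nn_integral_pair_pmf' split_beta)
  finally show ?thesis .
qed

text \<open>At worst four terms are -1/2 and one is 1; five is the number of elements that brings
  this down to -1.\<close>

lemma sum_all_but_one_le:
  fixes S :: "'b set"
  assumes "finite S" "card S = 5" "\<And>s s'. s \<in> S \<Longrightarrow> s' \<in> S \<Longrightarrow> \<not> P s \<Longrightarrow> \<not> P s' \<Longrightarrow> s = s'"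
  shows "(\<Sum>s\<in>S. if P s then - 1 / 2 else 1) \<le> (- 1 :: real)"
proof -
  have B: "card (S \<inter> - Collect P) \<le> 1"
    unfolding One_nat_def using assms(1,3) by (subst card_le_Suc0_iff_eq) auto
  have "card S = card (S \<inter> Collect P) + card (S \<inter> - Collect P)"
    using assms(1) by (subst card_Un_disjoint[symmetric]) (auto intro: arg_cong[where f = card])
  then have "real (card (S \<inter> Collect P)) = 5 - real (card (S \<inter> - Collect P))" using assms(2) by simp
  moreover have "real (card (S \<inter> - Collect P)) \<le> 1" using B by simp
  moreover have "(\<Sum>s\<in>S. if P s then - 1 / 2 else 1) =
      - real (card (S \<inter> Collect P)) / 2 + real (card (S \<inter> - Collect P))"
    using assms(1) by (simp add: sum.If_cases)
  ultimately show ?thesis by linarith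
qed

section \<open>Weights of aligned blocks\<close>

locale schottky_walk =
  fixes x0 :: "'a::metric_space" and \<mu> :: "('a \<Rightarrow> 'a) pmf" and q :: nat
    and S :: "('a \<Rightarrow> 'a) set" and L :: "'a \<Rightarrow> ('a \<Rightarrow> 'a) \<Rightarrow> bool" and R :: "('a \<Rightarrow> 'a) \<Rightarrow> 'a \<Rightarrow> bool"
    and C :: real
  assumes iso: "\<And>g. g \<in> set_pmf \<mu> \<Longrightarrow> isometry g"
    and finite_S: "finite S" and card_S: "card S = 5" and S_subset: "S \<subseteq> set_pmf (walk_law \<mu> q)"
    and L_unique: "\<And>s s' x. s \<in> S \<Longrightarrow> s' \<in> S \<Longrightarrow> \<not> L x s \<Longrightarrow> \<not> L x s' \<Longrightarrow> s = s'"
    and R_unique: "\<And>s s' y. s \<in> S \<Longrightarrow> s' \<in> S \<Longrightarrow> \<not> R s y \<Longrightarrow> \<not> R s' y \<Longrightarrow> s = s'"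
    and align: "\<And>s x y. s \<in> S \<Longrightarrow> L x s \<Longrightarrow> R s y \<Longrightarrow> dist x x0 + dist x0 y - C \<le> dist x (s y)"
begin

definition \<alpha> :: real where "\<alpha> = Min (pmf (walk_law \<mu> q) ` S)"

text \<open>Multiplied by \<open>wt\<close>, the block law gives the same mass \<alpha> to each
  element of \<open>S\<close>, so averages over a block become plain sums over
  \<open>S\<close>.\<close>

definition wt :: "('a \<Rightarrow> 'a) \<Rightarrow> real" where
  "wt g = (if g \<in> S then \<alpha> / pmf (walk_law \<mu> q) g else 0)"

lemma \<alpha>_le: "s \<in> S \<Longrightarrow> \<alpha> \<le> pmf (walk_law \<mu> q) s"
  unfolding \<alpha>_def using finite_S by simp

lemma \<alpha>_pos: "0 < \<alpha>"
proof -
  have "S \<noteq> {}" using card_S by auto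
  then show ?thesis
    unfolding \<alpha>_def using finite_S S_subset by (subst Min_gr_iff) (auto intro: pmf_positive)
qed

lemma \<alpha>_le_1: "\<alpha> \<le> 1"
proof -
  obtain s where "s \<in> S" using card_S by force
  then show ?thesis using \<alpha>_le[of s] pmf_le_1[of "walk_law \<mu> q" s] by linarith
qed

lemma wt_bounds: "0 \<le> wt g" "wt g \<le> 1"
  using \<alpha>_pos \<alpha>_le[of g] by (auto simp: wt_def divide_simps)

lemma expectation_wt:
  "(\<integral> g. wt g * c g \<partial>walk_law \<mu> q) = \<alpha> * (\<Sum>s\<in>S. c s)"
proof -
  have "(\<integral> g. wt g * c g \<partial>walk_law \<mu> q) = (\<Sum>s\<in>S. wt s * c s * pmf (walk_law \<mu> q) s)"
    using finite_S by (intro integral_measure_pmf_real) (auto simp: wt_def split: if_splits)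
  also have "\<dots> = (\<Sum>s\<in>S. \<alpha> * c s)"
    using \<alpha>_pos \<alpha>_le by (intro sum.cong) (force simp: wt_def)+
  finally show ?thesis by (simp add: sum_distrib_left)
qed

text \<open>\<open>X\<close> is the probability weight that a block is not a good splitting place. The misaligned factor
  \<open>2\<close> and the aligned factor \<open>1 / 2\<close> in \<open>U\<close> and \<open>V\<close> are chosen so that \<open>X\<^sup>2 \<le> U V\<close> while, with at most
  one misaligned element out of five, the mean of each is at most \<open>1 - \<alpha>\<close>. Since \<open>U\<close> sees only the past
  and \<open>V\<close> only the future, their products can be integrated one block at a time.\<close>

definition U :: "'a \<Rightarrow> ('a \<Rightarrow> 'a) \<Rightarrow> real" where
  "U x g = 1 + wt g * (if L x g then - 1 / 2 else 1)"

definition V :: "('a \<Rightarrow> 'a) \<Rightarrow> 'a \<Rightarrow> real" where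
  "V g y = 1 + wt g * (if R g y then - 1 / 2 else 1)"

definition X :: "'a \<Rightarrow> ('a \<Rightarrow> 'a) \<Rightarrow> 'a \<Rightarrow> real" where
  "X x g y = 1 - wt g * (if L x g \<and> R g y then 1 else 0)"

lemma U_nonneg: "0 \<le> U x g" and V_nonneg: "0 \<le> V g y" and X_nonneg: "0 \<le> X x g y"
  using wt_bounds[of g] by (auto simp: U_def V_def X_def)

text \<open>The tight case is a failure on exactly one side: with \<open>w = wt g\<close> the right
  side is \<open>(1 + w) * (1 - w / 2) = 1 + w * (1 - w) / 2\<close>, at least 1 since
  \<open>w\<close> lies between 0 and 1.\<close>

lemma X_le: "X x g y ^ 2 \<le> U x g * V g y"
proof -
  have "0 \<le> wt g * (1 - wt g)" using wt_bounds[of g] by simp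
  moreover have "0 \<le> wt g * wt g" by simp
  ultimately show ?thesis
    using wt_bounds[of g] by (auto simp: U_def V_def X_def power2_eq_square algebra_simps)
qed

lemma nn_integral_perturbation:
  assumes "\<And>s s'. s \<in> S \<Longrightarrow> s' \<in> S \<Longrightarrow> \<not> P s \<Longrightarrow> \<not> P s' \<Longrightarrow> s = s'"
  shows "(\<integral>\<^sup>+ g. ennreal (1 + wt g * (if P g then - 1 / 2 else 1)) \<partial>walk_law \<mu> q) \<le> ennreal (1 - \<alpha>)"
proof -
  let ?c = "\<lambda>g. if P g then - 1 / 2 else 1 :: real"
  have int: "integrable (walk_law \<mu> q) (\<lambda>g. wt g * ?c g)"
  proof (intro measure_pmf.integrable_const_bound[where B = 1] AE_I2)
    show "norm (wt g * ?c g) \<le> 1" for g using wt_bounds[of g] by (auto simp: abs_mult)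
  qed simp
  have "(\<integral>\<^sup>+ g. ennreal (1 + wt g * ?c g) \<partial>walk_law \<mu> q) = ennreal (\<integral> g. 1 + wt g * ?c g \<partial>walk_law \<mu> q)"
  proof (intro nn_integral_eq_integral AE_I2)
    show "0 \<le> 1 + wt g * ?c g" for g using wt_bounds[of g] by auto
  qed (use int in simp)
  also have "(\<integral> g. 1 + wt g * ?c g \<partial>walk_law \<mu> q) = 1 + \<alpha> * (\<Sum>s\<in>S. ?c s)"
    using int by (simp add: expectation_wt)
  also have "\<dots> \<le> 1 + \<alpha> * (- 1)"
    using sum_all_but_one_le[OF finite_S card_S assms] \<alpha>_pos
    by (intro add_left_mono mult_left_mono) auto
  finally show ?thesis by (simp add: ennreal_leI)
qed

lemma nn_integral_U: "(\<integral>\<^sup>+ g. ennreal (U x g) \<partial>walk_law \<mu> q) \<le> ennreal (1 - \<alpha>)"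
  unfolding U_def by (rule nn_integral_perturbation) (rule L_unique)

lemma nn_integral_V: "(\<integral>\<^sup>+ g. ennreal (V g y) \<partial>walk_law \<mu> q) \<le> ennreal (1 - \<alpha>)"
  unfolding V_def by (rule nn_integral_perturbation) (rule R_unique)

abbreviation comps :: "('a \<Rightarrow> 'a) list \<Rightarrow> 'a \<Rightarrow> 'a" where "comps gs \<equiv> foldr (\<circ>) gs id"

text \<open>The accumulator \<open>u\<close> is the walk before the block. It enters as
  \<open>inv u x0\<close> because \<open>dist x0 (u y) = dist (inv u x0) y\<close> for an isometry
  \<open>u\<close>.\<close>

primrec PU :: "('a \<Rightarrow> 'a) \<Rightarrow> ('a \<Rightarrow> 'a) list \<Rightarrow> real" where
  "PU u [] = 1"
| "PU u (g # gs) = U (inv u x0) g * PU (u \<circ> g) gs"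

primrec PV :: "('a \<Rightarrow> 'a) list \<Rightarrow> 'a \<Rightarrow> real" where
  "PV [] y = 1"
| "PV (g # gs) y = V g (comps gs y) * PV gs y"

primrec PX :: "('a \<Rightarrow> 'a) \<Rightarrow> ('a \<Rightarrow> 'a) list \<Rightarrow> 'a \<Rightarrow> real" where
  "PX u [] y = 1"
| "PX u (g # gs) y = X (inv u x0) g (comps gs y) * PX (u \<circ> g) gs y"

lemma PU_nonneg: "0 \<le> PU u gs" by (induction gs arbitrary: u) (auto simp: U_nonneg)
lemma PV_nonneg: "0 \<le> PV gs y" by (induction gs) (auto simp: V_nonneg)

text \<open>Cauchy-Schwarz blockwise, then the arithmetic-geometric mean inequality: the sum
  separates dependence on the past from dependence on the future, so each part can be integrated by
  itself.\<close>

lemma PX_le: "PX u gs y \<le> (PU u gs + PV gs y) / 2"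
proof -
  have "PX u gs y ^ 2 \<le> PU u gs * PV gs y"
  proof (induction gs arbitrary: u)
    case (Cons g gs)
    have "PX u (g # gs) y ^ 2 = X (inv u x0) g (comps gs y) ^ 2 * PX (u \<circ> g) gs y ^ 2"
      by (simp add: power_mult_distrib)
    also have "\<dots> \<le> (U (inv u x0) g * V g (comps gs y)) * (PU (u \<circ> g) gs * PV gs y)"
      by (intro mult_mono X_le Cons.IH) (auto simp: U_nonneg V_nonneg)
    finally show ?case by (simp add: mult_ac)
  qed simp
  also have "\<dots> \<le> ((PU u gs + PV gs y) / 2) ^ 2"
    using zero_le_square[of "PU u gs - PV gs y"] by (simp add: power2_eq_square field_simps)
  finally show ?thesis
    by (rule power2_le_imp_le) (simp add: PU_nonneg PV_nonneg)
qed

text \<open>The bound for the later blocks is uniform in their past, so they are integrated before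
  the first block.\<close>

lemma nn_integral_PU: "(\<integral>\<^sup>+ gs. ennreal (PU u gs) \<partial>replicate_pmf m (walk_law \<mu> q)) \<le> ennreal ((1 - \<alpha>) ^ m)"
proof (induction m arbitrary: u)
  case (Suc m)
  have "(\<integral>\<^sup>+ gs. ennreal (PU u gs) \<partial>replicate_pmf (Suc m) (walk_law \<mu> q)) =
      (\<integral>\<^sup>+ g. ennreal (U (inv u x0) g) * (\<integral>\<^sup>+ gs. ennreal (PU (u \<circ> g) gs) \<partial>replicate_pmf m (walk_law \<mu> q)) \<partial>walk_law \<mu> q)"
    by (simp add: ennreal_mult U_nonneg PU_nonneg nn_integral_cmult)
  also have "\<dots> \<le> (\<integral>\<^sup>+ g. ennreal (U (inv u x0) g) * ennreal ((1 - \<alpha>) ^ m) \<partial>walk_law \<mu> q)"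
    by (intro nn_integral_mono mult_left_mono Suc.IH) auto
  also have "\<dots> \<le> ennreal (1 - \<alpha>) * ennreal ((1 - \<alpha>) ^ m)"
    by (subst nn_integral_multc) (auto intro!: mult_right_mono nn_integral_U)
  finally show ?case using \<alpha>_le_1 by (simp add: ennreal_mult)
qed simp

text \<open>Here each factor sees only the later blocks, so the integrals are exchanged and the
  first block is integrated first.\<close>

lemma nn_integral_PV: "(\<integral>\<^sup>+ gs. ennreal (PV gs y) \<partial>replicate_pmf m (walk_law \<mu> q)) \<le> ennreal ((1 - \<alpha>) ^ m)"
proof (induction m)
  case (Suc m)
  have "(\<integral>\<^sup>+ gs. ennreal (PV gs y) \<partial>replicate_pmf (Suc m) (walk_law \<mu> q)) =
      (\<integral>\<^sup>+ g. \<integral>\<^sup>+ gs. ennreal (V g (comps gs y)) * ennreal (PV gs y) \<partial>replicate_pmf m (walk_law \<mu> q) \<partial>walk_law \<mu> q)"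
    by (simp add: ennreal_mult V_nonneg PV_nonneg)
  also have "\<dots> = (\<integral>\<^sup>+ gs. (\<integral>\<^sup>+ g. ennreal (V g (comps gs y)) \<partial>walk_law \<mu> q) * ennreal (PV gs y) \<partial>replicate_pmf m (walk_law \<mu> q))"
    by (subst nn_integral_pmf_swap) (simp add: nn_integral_multc)
  also have "\<dots> \<le> (\<integral>\<^sup>+ gs. ennreal (1 - \<alpha>) * ennreal (PV gs y) \<partial>replicate_pmf m (walk_law \<mu> q))"
    by (intro nn_integral_mono mult_right_mono nn_integral_V) auto
  also have "\<dots> \<le> ennreal (1 - \<alpha>) * ennreal ((1 - \<alpha>) ^ m)"
    by (subst nn_integral_cmult) (auto intro!: mult_left_mono Suc.IH)
  finally show ?case using \<alpha>_le_1 by (simp add: ennreal_mult)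
qed simp

section \<open>Splitting the walk at an aligned block\<close>

definition F :: "real \<Rightarrow> ('a \<Rightarrow> 'a) \<Rightarrow> real" where
  "F t w = exp (- t * dist x0 (w x0))"

text \<open>One term for each block of the window at which the walk can be cut; the block itself is
  dropped, the defect being accounted for by \<open>C\<close>.\<close>

primrec T :: "real \<Rightarrow> ('a \<Rightarrow> 'a) \<Rightarrow> ('a \<Rightarrow> 'a) list \<Rightarrow> ('a \<Rightarrow> 'a) \<Rightarrow> real" where
  "T t u [] v = 0"
| "T t u (g # gs) v = F t u * F t (comps gs \<circ> v) + T t (u \<circ> g) gs v"

lemma F_nonneg: "0 \<le> F t w" by (simp add: F_def)

lemma F_le_1: "0 \<le> t \<Longrightarrow> F t w \<le> 1" by (simp add: F_def)

lemma T_nonneg: "0 \<le> T t u gs v"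
  by (induction gs arbitrary: u) (auto simp: F_nonneg)

lemma F_aligned:
  assumes "0 \<le> t" "isometry u" "s \<in> S" "L (inv u x0) s" "R s (v x0)"
  shows "F t (u \<circ> s \<circ> v) \<le> exp (t * C) * (F t u * F t v)"
proof -
  have "dist x0 (u x0) + dist x0 (v x0) - C \<le> dist x0 ((u \<circ> s \<circ> v) x0)"
    using align[OF assms(3-5)] by (simp add: dist_isometry_inv[OF assms(2)])
  then have "t * (dist x0 (u x0) + dist x0 (v x0) - C) \<le> t * dist x0 ((u \<circ> s \<circ> v) x0)"
    using assms(1) by (rule mult_left_mono)
  then show ?thesis by (simp add: F_def exp_add[symmetric] algebra_simps)
qed

text \<open>The value is split with weights \<open>X\<close> and \<open>1 - X\<close> at the first
  block. The second weight vanishes unless the block is aligned on both sides, and then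
  \<open>F_aligned\<close> cuts there; with the first weight the block joins the past and the
  induction continues.\<close>

lemma F_le:
  assumes "0 \<le> t" "isometry u" "\<And>g. g \<in> set gs \<Longrightarrow> isometry g"
  shows "F t (u \<circ> comps gs \<circ> v) \<le> exp (t * C) * T t u gs v + PX u gs (v x0)"
  using assms(2,3)
proof (induction gs arbitrary: u)
  case Nil
  then show ?case using F_le_1[OF assms(1)] by simp
next
  case (Cons g gs)
  let ?f = "F t (u \<circ> comps (g # gs) \<circ> v)" and ?c = "exp (t * C)"
  let ?x = "X (inv u x0) g (comps gs (v x0))"
  have "?f = F t ((u \<circ> g) \<circ> comps gs \<circ> v)" by (simp add: o_assoc)
  also have "\<dots> \<le> ?c * T t (u \<circ> g) gs v + PX (u \<circ> g) gs (v x0)"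
    by (intro Cons.IH isometry_comp Cons.prems) simp_all
  finally have "?x * ?f \<le> ?x * (?c * T t (u \<circ> g) gs v + PX (u \<circ> g) gs (v x0))"
    by (rule mult_left_mono) (rule X_nonneg)
  also have "\<dots> \<le> 1 * (?c * T t (u \<circ> g) gs v) + ?x * PX (u \<circ> g) gs (v x0)"
    unfolding distrib_left using wt_bounds[of g] T_nonneg
    by (intro add_right_mono mult_right_mono) (auto simp: X_def)
  finally have 1: "?x * ?f \<le> ?c * T t (u \<circ> g) gs v + PX u (g # gs) (v x0)" by simp
  have 2: "(1 - ?x) * ?f \<le> ?c * (F t u * F t (comps gs \<circ> v))"
  proof (cases "g \<in> S \<and> L (inv u x0) g \<and> R g (comps gs (v x0))")
    case True
    then have "?f \<le> ?c * (F t u * F t (comps gs \<circ> v))"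
      using F_aligned[OF assms(1) Cons.prems(1), of g "comps gs \<circ> v"] by (simp add: o_assoc)
    moreover have "(1 - ?x) * ?f \<le> 1 * ?f"
      using wt_bounds[of g] F_nonneg by (intro mult_right_mono) (auto simp: X_def)
    ultimately show ?thesis by simp
  next
    case False
    then have "?x = 1" by (auto simp: X_def wt_def)
    then show ?thesis by (simp add: F_nonneg)
  qed
  have "?f = ?x * ?f + (1 - ?x) * ?f" by (simp only: distrib_right[symmetric]) simp
  moreover have "?c * T t u (g # gs) v = ?c * (F t u * F t (comps gs \<circ> v)) + ?c * T t (u \<circ> g) gs v"
    by (simp add: distrib_left)
  ultimately show ?case using 1 2 by linarith
qed

definition lap :: "real \<Rightarrow> nat \<Rightarrow> real" where
  "lap t n = (\<integral> w. F t w \<partial>walk_law \<mu> n)"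

lemma integrable_F: "0 \<le> t \<Longrightarrow> integrable (measure_pmf p) (F t)"
  by (intro measure_pmf.integrable_const_bound[where B = 1]) (auto simp: F_le_1 F_nonneg)

lemma nn_integral_F: "0 \<le> t \<Longrightarrow> (\<integral>\<^sup>+ w. ennreal (F t w) \<partial>walk_law \<mu> n) = ennreal (lap t n)"
  unfolding lap_def by (intro nn_integral_eq_integral integrable_F) (auto simp: F_nonneg)

lemma lap_nonneg: "0 \<le> lap t n"
  unfolding lap_def by (intro integral_nonneg_AE) (auto simp: F_nonneg)

text \<open>Past and future of the dropped block are independent, so each term integrates to a
  product of Laplace transforms.\<close>

lemma nn_integral_T:
  assumes "0 \<le> t"
  shows "(\<integral>\<^sup>+ u. \<integral>\<^sup>+ gs. \<integral>\<^sup>+ v. ennreal (T t u gs v) \<partial>walk_law \<mu> b \<partial>replicate_pmf m (walk_law \<mu> q) \<partial>walk_law \<mu> a)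
    = ennreal (\<Sum>i<m. lap t (a + i * q) * lap t ((m - Suc i) * q + b))"
proof (induction m arbitrary: a)
  case 0
  then show ?case by simp
next
  case (Suc m)
  let ?\<nu> = "walk_law \<mu> q"
  have A: "(\<integral>\<^sup>+ gs. \<integral>\<^sup>+ v. ennreal (F t (comps gs \<circ> v)) \<partial>walk_law \<mu> b \<partial>replicate_pmf m ?\<nu>) = ennreal (lap t (m * q + b))"
    unfolding nn_integral_F[OF assms, symmetric] nn_integral_walk_law_add by (simp add: walk_law_mult)
  have "(\<integral>\<^sup>+ u. \<integral>\<^sup>+ gs. \<integral>\<^sup>+ v. ennreal (T t u gs v) \<partial>walk_law \<mu> b \<partial>replicate_pmf (Suc m) ?\<nu> \<partial>walk_law \<mu> a) =
    (\<integral>\<^sup>+ u. \<integral>\<^sup>+ g. ennreal (F t u) * ennreal (lap t (m * q + b)) +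
       (\<integral>\<^sup>+ gs. \<integral>\<^sup>+ v. ennreal (T t (u \<circ> g) gs v) \<partial>walk_law \<mu> b \<partial>replicate_pmf m ?\<nu>) \<partial>?\<nu> \<partial>walk_law \<mu> a)"
    by (simp add: ennreal_plus ennreal_mult F_nonneg T_nonneg nn_integral_add nn_integral_cmult A)
  also have "\<dots> = ennreal (lap t a) * ennreal (lap t (m * q + b)) +
     (\<integral>\<^sup>+ u. \<integral>\<^sup>+ gs. \<integral>\<^sup>+ v. ennreal (T t u gs v) \<partial>walk_law \<mu> b \<partial>replicate_pmf m ?\<nu> \<partial>walk_law \<mu> (a + q))"
    by (simp add: nn_integral_add nn_integral_multc nn_integral_F[OF assms] nn_integral_walk_law_add)
  also have "\<dots> = ennreal (lap t a * lap t (m * q + b) + (\<Sum>i<m. lap t (a + q + i * q) * lap t ((m - Suc i) * q + b)))"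
    unfolding Suc.IH by (simp add: ennreal_plus ennreal_mult lap_nonneg sum_nonneg)
  also have "\<dots> = ennreal (\<Sum>i<Suc m. lap t (a + i * q) * lap t ((Suc m - Suc i) * q + b))"
    by (subst sum.lessThan_Suc_shift) (simp add: algebra_simps)
  finally show ?case .
qed

lemma lap_recursion:
  assumes t: "0 \<le> t"
  shows "lap t (a + m * q + b) \<le>
    exp (t * C) * (\<Sum>i<m. lap t (a + i * q) * lap t ((m - Suc i) * q + b)) + (1 - \<alpha>) ^ m"
proof -
  let ?\<nu> = "walk_law \<mu> q" and ?c = "exp (t * C)" and ?\<Sigma> = "\<Sum>i<m. lap t (a + i * q) * lap t ((m - Suc i) * q + b)"
  let ?I = "\<lambda>f. \<integral>\<^sup>+ u. \<integral>\<^sup>+ gs. \<integral>\<^sup>+ v. f u gs v \<partial>walk_law \<mu> b \<partial>replicate_pmf m ?\<nu> \<partial>walk_law \<mu> a"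
  have "ennreal (lap t (a + m * q + b)) = ?I (\<lambda>u gs v. ennreal (F t (u \<circ> comps gs \<circ> v)))"
    unfolding nn_integral_F[OF t, symmetric] nn_integral_walk_law_add by (simp add: walk_law_mult)
  also have "\<dots> \<le> ?I (\<lambda>u gs v. ennreal (?c * T t u gs v + (PU u gs + PV gs (v x0)) / 2))"
  proof (intro nn_integral_mono_AE AE_pmfI)
    fix u gs v
    assume "u \<in> set_pmf (walk_law \<mu> a)" "gs \<in> set_pmf (replicate_pmf m ?\<nu>)"
    then have 1: "isometry u" and 2: "\<And>g. g \<in> set gs \<Longrightarrow> isometry g"
      using isometry_walk_law[OF iso] by (auto simp: set_replicate_pmf)
    show "ennreal (F t (u \<circ> comps gs \<circ> v)) \<le> ennreal (?c * T t u gs v + (PU u gs + PV gs (v x0)) / 2)"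
      using F_le[OF t 1 2, of gs v] PX_le[of u gs "v x0"] by (intro ennreal_leI) linarith
  qed
  also have "\<dots> = ennreal ?c * ?I (\<lambda>u gs v. ennreal (T t u gs v)) +
      (?I (\<lambda>u gs v. ennreal (PU u gs)) + ?I (\<lambda>u gs v. ennreal (PV gs (v x0)))) / 2"
  proof -
    have "ennreal (?c * T t u gs v + (PU u gs + PV gs (v x0)) / 2) =
      ennreal ?c * ennreal (T t u gs v) + (ennreal (PU u gs) + ennreal (PV gs (v x0))) / 2" for u gs v
      using PU_nonneg[of u gs] PV_nonneg[of gs "v x0"] T_nonneg[of t u gs v]
      by (simp add: ennreal_plus ennreal_mult ennreal_divide_numeral[symmetric] del: ennreal_plus_if)
    then show ?thesis
      by (simp add: nn_integral_add nn_integral_cmult nn_integral_divide)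
  qed
  also have "\<dots> \<le> ennreal ?c * ennreal ?\<Sigma> + (ennreal ((1 - \<alpha>) ^ m) + ennreal ((1 - \<alpha>) ^ m)) / 2"
  proof (intro add_mono mult_left_mono divide_right_mono_ennreal)
    show "?I (\<lambda>u gs v. ennreal (T t u gs v)) \<le> ennreal ?\<Sigma>" by (simp add: nn_integral_T[OF t])
    have "?I (\<lambda>u gs v. ennreal (PU u gs)) \<le> (\<integral>\<^sup>+ u. ennreal ((1 - \<alpha>) ^ m) \<partial>walk_law \<mu> a)"
      by (intro nn_integral_mono) (simp add: nn_integral_PU)
    then show "?I (\<lambda>u gs v. ennreal (PU u gs)) \<le> ennreal ((1 - \<alpha>) ^ m)" by simp
    \<comment> \<open>\<open>nn_integral_PV\<close> needs a fixed endpoint, so the future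
      \<open>v\<close> is moved to the outer integral.\<close>
    have "?I (\<lambda>u gs v. ennreal (PV gs (v x0))) =
        (\<integral>\<^sup>+ v. \<integral>\<^sup>+ gs. ennreal (PV gs (v x0)) \<partial>replicate_pmf m ?\<nu> \<partial>walk_law \<mu> b)"
      by (subst nn_integral_pmf_swap) simp
    also have "\<dots> \<le> (\<integral>\<^sup>+ v. ennreal ((1 - \<alpha>) ^ m) \<partial>walk_law \<mu> b)"
      by (intro nn_integral_mono nn_integral_PV)
    finally show "?I (\<lambda>u gs v. ennreal (PV gs (v x0))) \<le> ennreal ((1 - \<alpha>) ^ m)" by simp
  qed auto
  also have "\<dots> = ennreal (?c * ?\<Sigma> + (1 - \<alpha>) ^ m)"
  proof -
    have "(ennreal ((1 - \<alpha>) ^ m) + ennreal ((1 - \<alpha>) ^ m)) / 2 = ennreal ((1 - \<alpha>) ^ m)"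
      using \<alpha>_le_1 by (simp add: ennreal_plus[symmetric] ennreal_divide_numeral del: ennreal_plus)
    moreover have "0 \<le> ?\<Sigma>" by (intro sum_nonneg mult_nonneg_nonneg lap_nonneg)
    ultimately show ?thesis using \<alpha>_le_1 by (simp add: ennreal_mult)
  qed
  finally show ?thesis
    using \<alpha>_le_1 by (subst (asm) ennreal_le_iff) (auto intro!: add_nonneg_nonneg mult_nonneg_nonneg sum_nonneg lap_nonneg)
qed

end

section \<open>Drift and conclusion\<close>

lemma walk_law_1: "walk_law \<mu> (Suc 0) = \<mu>"
  by (simp add: bind_return_pmf bind_return_pmf' map_pmf_def)

lemma semigroup_gen_walk_law:
  assumes "w \<in> semigroup_gen (set_pmf \<mu>)"
  obtains n where "0 < n" "w \<in> set_pmf (walk_law \<mu> n)"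
proof -
  have "\<exists>n>0. w \<in> set_pmf (walk_law \<mu> n)"
    using assms
  proof induction
    case (base s)
    then show ?case by (intro exI[of _ "Suc 0"]) (simp only: walk_law_1, simp)
  next
    case (comp a b)
    then obtain m n where "0 < m" "a \<in> set_pmf (walk_law \<mu> m)" "b \<in> set_pmf (walk_law \<mu> n)" by blast
    then have "0 < m + n" "a \<circ> b \<in> set_pmf (walk_law \<mu> (m + n))" by (auto simp: walk_law_add)
    then show ?case by blast
  qed
  then show ?thesis using that by blast
qed

lemma comp_in_walk_law:
  assumes "a \<in> set_pmf (walk_law \<mu> m)" "b \<in> set_pmf (walk_law \<mu> n)"
  shows "a \<circ> b \<in> set_pmf (walk_law \<mu> (m + n))"
  using assms by (auto simp: walk_law_add)

lemma funpow_in_walk_law: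
  assumes "w \<in> set_pmf (walk_law \<mu> n)" shows "w ^^ k \<in> set_pmf (walk_law \<mu> (n * k))"
proof (induction k)
  case (Suc k)
  have "w \<circ> w ^^ k \<in> set_pmf (walk_law \<mu> (n + n * k))" by (rule comp_in_walk_law[OF assms Suc])
  then show ?case by (simp only: funpow.simps mult_Suc_right)
qed (simp add: id_def)

section \<open>From sample paths to the laws of the walk\<close>

lemma walk_path_Suc: "walk_path s (Suc n) = shd s \<circ> walk_path (stl s) n"
  by (simp only: walk_path_def stake.simps foldr.simps)  simp

text \<open>Replacing increments outside the support by the identity makes the walk countably valued,
  hence measurable; on the uncountable type of all maps composition need not be.\<close>

definition supp_step :: "('a \<Rightarrow> 'a) pmf \<Rightarrow> ('a \<Rightarrow> 'a) \<Rightarrow> 'a \<Rightarrow> 'a" where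
  "supp_step \<mu> g = (if g \<in> set_pmf \<mu> then g else id)"

definition supp_path :: "('a \<Rightarrow> 'a) pmf \<Rightarrow> nat \<Rightarrow> ('a \<Rightarrow> 'a) stream \<Rightarrow> 'a \<Rightarrow> 'a" where
  "supp_path \<mu> n s = walk_path (smap (supp_step \<mu>) s) n"

lemma supp_path_Suc: "supp_path \<mu> (Suc n) s = supp_step \<mu> (shd s) \<circ> supp_path \<mu> n (stl s)"
  by (simp only: supp_path_def walk_path_Suc stream.map_sel)

lemma measurable_supp_path:
  "supp_path \<mu> n \<in> stream_space (measure_pmf \<mu>) \<rightarrow>\<^sub>M count_space UNIV"
proof (induction n)
  case 0
  then show ?case by (simp add: supp_path_def walk_path_def)
next
  case (Suc n)
  have "(\<lambda>s. supp_step \<mu> (shd s) \<circ> supp_path \<mu> n (stl s)) \<in> stream_space (measure_pmf \<mu>) \<rightarrow>\<^sub>M count_space UNIV"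
  proof (rule measurable_compose_countable'[where I = "insert id (set_pmf \<mu>)" and
        f = "\<lambda>i s. i \<circ> supp_path \<mu> n (stl s)" and g = "\<lambda>s. supp_step \<mu> (shd s)"])
    show "(\<lambda>s. i \<circ> supp_path \<mu> n (stl s)) \<in> stream_space (measure_pmf \<mu>) \<rightarrow>\<^sub>M count_space UNIV" for i
      by (rule measurable_compose[OF measurable_compose[OF measurable_stl Suc.IH]]) simp
    show "(\<lambda>s. supp_step \<mu> (shd s)) \<in> stream_space (measure_pmf \<mu>) \<rightarrow>\<^sub>M count_space (insert id (set_pmf \<mu>))"
      by (rule measurable_compose[OF measurable_shd]) (auto simp: measurable_def supp_step_def)
  qed simp
  then show ?case by (simp only: supp_path_Suc[abs_def])
qed

text \<open>Streams peel off the first increment whereas \<open>walk_law\<close> appends the last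
  one; \<open>nn_integral_walk_law_add\<close> with one step in front reconciles them.\<close>

lemma nn_integral_supp_path:
  "(\<integral>\<^sup>+ s. f (supp_path \<mu> n s) \<partial>stream_space (measure_pmf \<mu>)) = (\<integral>\<^sup>+ w. f w \<partial>walk_law \<mu> n)"
proof (induction n arbitrary: f)
  case 0
  interpret S: prob_space "stream_space (measure_pmf \<mu>)"
    by (rule prob_space.prob_space_stream_space[OF prob_space_measure_pmf])
  show ?case by (simp add: supp_path_def walk_path_def S.emeasure_space_1 id_def)
next
  case (Suc n)
  have "(\<integral>\<^sup>+ s. f (supp_path \<mu> (Suc n) s) \<partial>stream_space (measure_pmf \<mu>)) =
      (\<integral>\<^sup>+ g. \<integral>\<^sup>+ s. f (supp_path \<mu> (Suc n) (g ## s)) \<partial>stream_space (measure_pmf \<mu>) \<partial>\<mu>)"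
    by (rule prob_space.nn_integral_stream_space[OF prob_space_measure_pmf], rule measurable_compose[OF measurable_supp_path]) simp
  also have "\<dots> = (\<integral>\<^sup>+ g. \<integral>\<^sup>+ w. f (supp_step \<mu> g \<circ> w) \<partial>walk_law \<mu> n \<partial>\<mu>)"
    unfolding supp_path_Suc stream.sel using Suc.IH[of "\<lambda>w. f (supp_step \<mu> _ \<circ> w)"]
    by (intro nn_integral_cong) blast
  also have "\<dots> = (\<integral>\<^sup>+ g. \<integral>\<^sup>+ w. f (g \<circ> w) \<partial>walk_law \<mu> n \<partial>\<mu>)"
    by (intro nn_integral_cong_AE AE_pmfI) (simp add: supp_step_def)
  also have "\<dots> = (\<integral>\<^sup>+ w. f w \<partial>walk_law \<mu> (Suc 0 + n))"
    by (simp only: nn_integral_walk_law_add walk_law_1)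
  finally show ?case by simp
qed

lemma AE_supp_path:
  "AE s in stream_space (measure_pmf \<mu>). \<forall>n. supp_path \<mu> n s = walk_path s n"
proof -
  have "AE s in stream_space (measure_pmf \<mu>). stream_all (\<lambda>g. g \<in> set_pmf \<mu>) s"
    by (rule prob_space.AE_stream_all[OF prob_space_measure_pmf]) (auto simp: AE_measure_pmf)
  then show ?thesis
  proof eventually_elim
    case (elim s)
    then have "smap (supp_step \<mu>) s = smap id s"
      by (intro stream.map_cong0) (auto simp: supp_step_def stream_all_def sset_range)
    then show ?case by (simp add: supp_path_def stream.map_id)
  qed
qed

text \<open>Almost surely the slow event fails from some time on, so its indicators tend to 0, and
  dominated convergence applies.\<close>

lemma prob_slow_tendsto_0:
  fixes x0 :: "'a::metric_space"
  assumes lim: "AE s in stream_space (measure_pmf \<mu>).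
      ((\<lambda>n. ereal (dist x0 (walk_path s n x0) / real n)) \<longlongrightarrow> lam) sequentially"
    and "ereal l < lam"
  shows "(\<lambda>n. measure_pmf.prob (walk_law \<mu> n) {w. dist x0 (w x0) \<le> l * real n}) \<longlonglongrightarrow> 0"
proof -
  let ?S = "stream_space (measure_pmf \<mu>)"
  define B where "B n = {w :: 'a \<Rightarrow> 'a. dist x0 (w x0) \<le> l * real n}" for n :: nat
  interpret S: prob_space ?S by (rule prob_space.prob_space_stream_space[OF prob_space_measure_pmf])
  have meas: "(\<lambda>s. indicator (B n) (supp_path \<mu> n s) :: real) \<in> borel_measurable ?S" for n
    by (rule measurable_compose[OF measurable_supp_path]) simp
  have "(\<lambda>n. \<integral> s. indicator (B n) (supp_path \<mu> n s) \<partial>?S) \<longlonglongrightarrow> (\<integral> s. (0 :: real) \<partial>?S)"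
  proof (rule integral_dominated_convergence[where w = "\<lambda>_. 1"])
    show "AE s in ?S. (\<lambda>n. indicator (B n) (supp_path \<mu> n s)) \<longlonglongrightarrow> (0 :: real)"
      using lim AE_supp_path
    proof eventually_elim
      case (elim s)
      have "eventually (\<lambda>n. ereal l < ereal (dist x0 (walk_path s n x0) / real n)) sequentially"
        using elim(1) assms(2) by (rule order_tendstoD)
      then have "eventually (\<lambda>n. indicator (B n) (supp_path \<mu> n s) = (0 :: real)) sequentially"
        \<comment> \<open>Time 0 is discarded because of the division by
          \<open>real n\<close>.\<close>
        using eventually_gt_at_top[of 0]
        by eventually_elim (simp add: B_def elim(2) indicator_def pos_less_divide_eq not_le)
      then show ?case by (rule tendsto_eventually)
    qed
  qed (simp_all add: meas)
  moreover have "(\<integral> s. indicator (B n) (supp_path \<mu> n s) \<partial>?S) = measure_pmf.prob (walk_law \<mu> n) (B n)" for n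
  proof -
    have "ennreal (\<integral> s. indicator (B n) (supp_path \<mu> n s) \<partial>?S) = (\<integral>\<^sup>+ s. ennreal (indicator (B n) (supp_path \<mu> n s)) \<partial>?S)"
    proof (rule nn_integral_eq_integral[symmetric])
      show "integrable ?S (\<lambda>s. indicator (B n) (supp_path \<mu> n s) :: real)"
        by (rule S.integrable_const_bound[where B = 1], simp, rule meas)
    qed simp
    also have "\<dots> = ennreal (measure_pmf.prob (walk_law \<mu> n) (B n))"
      unfolding nn_integral_supp_path[where f = "\<lambda>w. ennreal (indicator (B n) w)"]
      by (simp add: ennreal_indicator measure_pmf.emeasure_eq_measure)
    finally show ?thesis by (simp add: integral_nonneg_AE)
  qed
  ultimately show ?thesis by (simp add: B_def)
qed

lemma integrable_indicator_pmf: "integrable (measure_pmf p) (indicator A :: _ \<Rightarrow> real)"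
  by (intro measure_pmf.integrable_const_bound[where B = 1]) auto

section \<open>Laplace transform versus slow probability\<close>

context schottky_walk
begin

lemma lap_le:
  assumes "0 \<le> t"
  shows "lap t n \<le> exp (- t * l * real n) + measure_pmf.prob (walk_law \<mu> n) {w. dist x0 (w x0) \<le> l * real n}"
proof -
  let ?B = "{w. dist x0 (w x0) \<le> l * real n}"
  have "lap t n \<le> (\<integral> w. exp (- t * l * real n) + indicator ?B w \<partial>walk_law \<mu> n)"
    unfolding lap_def
  proof (intro integral_mono integrable_F assms)
    fix w
    show "F t w \<le> exp (- t * l * real n) + indicator ?B w"
    proof (cases "w \<in> ?B")
      case True
      then show ?thesis using F_le_1[OF assms, of w] by (simp add: add_increasing)
    next
      case False
      then have "t * (l * real n) \<le> t * dist x0 (w x0)" using assms by (intro mult_left_mono) auto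
      then show ?thesis using False by (simp add: F_def mult.assoc)
    qed
  qed (simp add: integrable_indicator_pmf)
  then show ?thesis by (simp add: integrable_indicator_pmf)
qed

lemma prob_le_lap:
  assumes "0 \<le> t"
  shows "measure_pmf.prob (walk_law \<mu> n) {w. dist x0 (w x0) \<le> l * real n} \<le> exp (t * l * real n) * lap t n"
proof -
  let ?B = "{w. dist x0 (w x0) \<le> l * real n}"
  have "(\<integral> w. indicator ?B w \<partial>walk_law \<mu> n) \<le> (\<integral> w. exp (t * l * real n) * F t w \<partial>walk_law \<mu> n)"
  proof (intro integral_mono integrable_mult_right integrable_F assms)
    fix w
    show "indicator ?B w \<le> exp (t * l * real n) * F t w"
    proof (cases "w \<in> ?B")
      case True
      then have "t * dist x0 (w x0) \<le> t * (l * real n)" using assms by (intro mult_left_mono) auto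
      then show ?thesis using True by (simp add: F_def exp_add[symmetric] mult.assoc)
    qed (simp add: F_nonneg)
  qed (simp add: integrable_indicator_pmf)
  then show ?thesis by (simp add: lap_def)
qed

end

text \<open>Both isometries are values of the walk at some positive times, so all five words are
  values of the walk at one common positive time \<open>q\<close>.\<close>

lemma non_elementary_schottky_walk:
  fixes x0 :: "'a::metric_space"
  assumes geo: "geodesic_space TYPE('a)" and iso: "\<And>g. g \<in> set_pmf \<mu> \<Longrightarrow> isometry g"
    and ne: "non_elementary x0 \<mu>"
  obtains q S L R C where "0 < q" "schottky_walk x0 \<mu> q S L R C"
proof -
  obtain g h where gen: "g \<in> semigroup_gen (set_pmf \<mu>)" "h \<in> semigroup_gen (set_pmf \<mu>)"
    and contr: "contracting_isometry x0 g" "contracting_isometry x0 h" and ind: "independent x0 g h"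
    using ne unfolding non_elementary_def by blast
  obtain Kg Kh where Kg: "0 < Kg" "quasi_geodesic Kg (\<lambda>n. zpow g n x0)" "contracting_set Kg (range (\<lambda>n. zpow g n x0))"
    and Kh: "0 < Kh" "quasi_geodesic Kh (\<lambda>n. zpow h n x0)" "contracting_set Kh (range (\<lambda>n. zpow h n x0))"
    using contr unfolding contracting_isometry_def by blast
  interpret independent_axes x0 g h "max Kg Kh"
    using geo contr ind Kg Kh
    by unfold_locales (auto simp: contracting_isometry_def intro: contracting_set_mono quasi_geodesic_mono)
  obtain a where a: "0 < a" "g \<in> set_pmf (walk_law \<mu> a)" using semigroup_gen_walk_law[OF gen(1)] .
  obtain b where b: "0 < b" "h \<in> set_pmf (walk_law \<mu> b)" using semigroup_gen_walk_law[OF gen(2)] .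
  show ?thesis
  proof (rule schottky_family)
    fix M m :: nat and L R :: "nat \<Rightarrow> 'a \<Rightarrow> bool" and C and s :: "nat \<Rightarrow> 'a \<Rightarrow> 'a"
    assume s: "\<And>i. s i = (g ^^ (M * (i + 1))) \<circ> (h ^^ m) \<circ> (g ^^ (M * (5 - i)))"
      and M: "0 < M" and inj: "inj_on s {..<5}"
      and L: "\<And>i j x. i < 5 \<Longrightarrow> j < 5 \<Longrightarrow> \<not> L i x \<Longrightarrow> \<not> L j x \<Longrightarrow> i = j"
      and R: "\<And>i j x. i < 5 \<Longrightarrow> j < 5 \<Longrightarrow> \<not> R i x \<Longrightarrow> \<not> R j x \<Longrightarrow> i = j"
      and align: "\<And>i x y. i < 5 \<Longrightarrow> L i x \<Longrightarrow> R i y \<Longrightarrow> dist x x0 + dist x0 y - C \<le> dist x (s i y)"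
    define q where "q = a * (M * 6) + b * m"
    have mem: "s i \<in> set_pmf (walk_law \<mu> q)" if "i < 5" for i
    proof -
      have "s i \<in> set_pmf (walk_law \<mu> (a * (M * (i + 1)) + b * m + a * (M * (5 - i))))"
        unfolding s by (intro comp_in_walk_law funpow_in_walk_law a b)
      also have "a * (M * (i + 1)) + b * m + a * (M * (5 - i)) = a * (M * ((i + 1) + (5 - i))) + b * m"
        by (simp only: distrib_left ac_simps)
      also have "(i + 1) + (5 - i) = 6" using that by simp
      finally show ?thesis by (simp only: q_def)
    qed
    \<comment> \<open>The locale speaks of maps instead of indices, so each predicate quantifies
      over the indices that represent the given map.\<close>
    have "schottky_walk x0 \<mu> q (s ` {..<5}) (\<lambda>x f. \<forall>i<5. f = s i \<longrightarrow> L i x) (\<lambda>f y. \<forall>i<5. f = s i \<longrightarrow> R i y) C"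
    proof
      show "card (s ` {..<5}) = 5" using card_image[OF inj] by simp
      show "s ` {..<5} \<subseteq> set_pmf (walk_law \<mu> q)" using mem by auto
      show "f = f'" if "\<not> (\<forall>i<5. f = s i \<longrightarrow> L i x)" "\<not> (\<forall>i<5. f' = s i \<longrightarrow> L i x)" for f f' x
        using that L by blast
      show "f = f'" if "\<not> (\<forall>i<5. f = s i \<longrightarrow> R i y)" "\<not> (\<forall>i<5. f' = s i \<longrightarrow> R i y)" for f f' y
        using that R by blast
      show "dist x x0 + dist x0 y - C \<le> dist x (f y)"
        if "f \<in> s ` {..<5}" "\<forall>i<5. f = s i \<longrightarrow> L i x" "\<forall>i<5. f = s i \<longrightarrow> R i y" for f x y
        using that align by blast
    qed (use iso in auto)
    moreover have "0 < q" using a M by (simp add: q_def)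
    ultimately show ?thesis using that by blast
  qed
qed

theorem theorem1p6:
  fixes G :: "('a::metric_space \<Rightarrow> 'a) set" and x0 :: 'a
    and \<mu> :: "('a \<Rightarrow> 'a) pmf" and lam :: ereal
  assumes "geodesic_space TYPE('a)"
    and "isometry_group G" and "countable G"
    and "\<exists>g\<in>G. \<exists>h\<in>G. contracting_isometry x0 g \<and> contracting_isometry x0 h \<and> independent x0 g h"
    and "set_pmf \<mu> \<subseteq> G"
    and "non_elementary x0 \<mu>"
    and "AE s in stream_space (measure_pmf \<mu>).
           ((\<lambda>n. ereal (dist x0 (walk_path s n x0) / real n)) \<longlongrightarrow> lam) sequentially"
  shows "\<forall>L::real. 0 < L \<and> ereal L < lam \<longrightarrow>
           (\<exists>K>0. \<forall>n::nat. measure_pmf.prob (walk_law \<mu> n) {w. dist x0 (w x0) \<le> L * real n}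
                       \<le> K * exp (- real n / K))"
proof (intro allI impI)
  fix L :: real assume L: "0 < L \<and> ereal L < lam"
  \<comment> \<open>The gap between \<open>L\<close> and \<open>L'\<close> pays for the losses in
    the recursion.\<close>
  obtain L' where L': "L < L'" "ereal L' < lam"
    using L ereal_dense2[of "ereal L" lam] by auto
  have iso: "isometry g" if "g \<in> set_pmf \<mu>" for g
    using that assms(2,5) by (auto simp: isometry_group_def)
  obtain q S A R C where "0 < q" and sw: "schottky_walk x0 \<mu> q S A R C"
    using non_elementary_schottky_walk[OF assms(1) iso assms(6)] .
  interpret schottky_walk x0 \<mu> q S A R C by (rule sw)
  let ?P = "\<lambda>n. measure_pmf.prob (walk_law \<mu> n) {w. dist x0 (w x0) \<le> L * real n}"
  obtain t \<theta> N where t: "0 < t" and \<theta>: "0 < \<theta>"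
    and decay: "\<And>n. N \<le> n \<Longrightarrow> exp (t * L * real n) * lap t n \<le> exp (- \<theta> * real n)"
  proof (rule exponential_decay[of q "1 - \<alpha>" L L' lap C "\<lambda>n. measure_pmf.prob (walk_law \<mu> n) {w. dist x0 (w x0) \<le> L' * real n}"])
    show "(\<lambda>n. measure_pmf.prob (walk_law \<mu> n) {w. dist x0 (w x0) \<le> L' * real n}) \<longlonglongrightarrow> 0"
      by (rule prob_slow_tendsto_0[OF assms(7) L'(2)])
  qed (use \<open>0 < q\<close> \<alpha>_pos \<alpha>_le_1 L L' lap_nonneg lap_recursion lap_le in auto)
  \<comment> \<open>For \<open>n\<close> below \<open>N\<close>, \<open>real N\<close> keeps
    \<open>n / K\<close> at most 1 and \<open>exp 1\<close> then makes the bound at least 1;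
    \<open>1 / \<theta>\<close> serves the remaining \<open>n\<close>.\<close>
  define K where "K = max (exp 1) (max (real N) (1 / \<theta>))"
  have K: "0 < K" "exp 1 \<le> K" "real N \<le> K" "1 / \<theta> \<le> K" by (auto simp: K_def less_max_iff_disj)
  have "?P n \<le> K * exp (- real n / K)" for n
  proof (cases "N \<le> n")
    case True
    have "?P n \<le> exp (t * L * real n) * lap t n" using t by (intro prob_le_lap) simp
    also have "\<dots> \<le> exp (- \<theta> * real n)" by (rule decay[OF True])
    also have "\<dots> \<le> 1 * exp (- real n / K)"
    proof -
      have "1 / K \<le> \<theta>" using K(1,4) \<theta> by (simp add: divide_simps mult.commute)
      then have "1 / K * real n \<le> \<theta> * real n" by (rule mult_right_mono) simp
      then show ?thesis by simp
    qed
    also have "\<dots> \<le> K * exp (- real n / K)"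
      using K(2) exp_ge_add_one_self[of 1] by (intro mult_right_mono) auto
    finally show ?thesis .
  next
    case False
    then have "real n / K \<le> 1" using K(1,3) by simp
    then have "exp 1 * exp (- 1) \<le> K * exp (- real n / K)" using K by (intro mult_mono) auto
    then have "1 \<le> K * exp (- real n / K)" by (simp add: exp_minus)
    then show ?thesis using measure_pmf.prob_le_1 order_trans by blast
  qed
  then show "\<exists>K>0. \<forall>n. ?P n \<le> K * exp (- real n / K)" using K(1) by blast
qed

end
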